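(* Let $Z=\mathcal O\oplus\mathcal O(1)\oplus\mathcal O(1)$. The induced geometry on the moduli space $M$ of global sections of $Z\to\mathbb{P}^1$ is that of a complex five-dimensional Newton-Cartan spacetime $(M,h,\theta,\nabla)$ (induced in the sense of the context), where the connection components of $\nabla$ depend (up to diffeomorphisms of the time axis) on one conformal factor and seven arbitrary functions, \begin{itemize} \item four of which are the Newtonian gravitational force $\Gamma^i_{\ tt}$; \item and the remaining three of which form an anti-self-dual spatial two-form $W_{ij}$ describing Coriolis forces (i.e. giving the trace-free part of $\Gamma^i_{\ jt}$, with one index lowered by the spatial metric). \end{itemize}
   Context: Notation. Cover $\mathbb{P}^1$ by $U,\hat U$ with coordinates $\lambda$ and $\hat\lambda=\lambda^{-1}$. $Z$ has fibre coordinates $w=(T,\Omega^A)$, $\hat w=(\hat T,\hat\Omega^A)$, $A=0,1$, with patching $\hat T=T$, $\hat\Omega^A=\lambda^{-1}\Omega^A$. Its global sections $X_x$ are $T|=t$, $\Omega^A|=x^{A1'}+x^{A0'}\lambda$, so $M=\mathbb{C}^5$ has coordinates $x^a=(t,x^{AA'})$; write $x^{00'}=v$, $x^{01'}=u$, $x^{10'}=y$, $x^{11'}=x$. Spatial indices $i,j$ run over $x^{AA'}$; the spatial fibres are $\{t=\text{const}\}$, with flat metric conformal to $\epsilon_{AB}\epsilon_{A'B'}dx^{AA'}dx^{BB'}$ and oriented by the volume form $dx\wedge dy\wedge dv\wedge du$, which defines anti-self-duality. All objects are holomorphic. A vertical slash denotes restriction to $X_x$. The normal bundle $N_x\cong\mathcal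 O\oplus\mathcal O(1)\oplus\mathcal O(1)$ has patching $\mathcal F^\mu_{\ \nu}=\frac{\partial\hat w^\mu}{\partial w^\nu}|=\mathrm{diag}(1,\lambda^{-1},\lambda^{-1})$; put $\mathcal F^\mu_{\ \nu\rho}=\frac{\partial^2\hat w^\mu}{\partial w^\nu\partial w^\rho}|$ $(=0$ here$)$. Newton-Cartan spacetime (complex, five-dimensional): $(M,h,\theta,\nabla)$ where $h$ is a symmetric contravariant 2-tensor field of rank four (the metric), $\theta$ is a closed one-form spanning the kernel of $h$ (the clock), and $\nabla$ is a torsion-free affine connection with $\nabla h=0$, $\nabla\theta=0$. Frame: the frame section is $v=H^{-1}dw|$ ($d$ is the exterior derivative on $M$ at fixed $\lambda$), where $\mathcal F=\hat H\,\mathrm{diag}(1,\lambda^{-1},\lambda^{-1})H^{-1}$ with $H$, $\hat H$ holomorphic maps from $U$, $\hat U$ to $\mathrm{GL}(3,\mathbb{C})$ for each $x$, $H$ being determined only up to right multiplication by an invertible global section of $N_x\otimes N_x^*$ varying arbitrarily (holomorphically) with $x$. Its components are $v=(\theta,\ e^{A1'}+e^{A0'}\lambda)$, defining the clock $\theta$ and one-forms $e^{AA'}$. The covariant degenerate metric is $h^{-1}=\epsilon_{AB}\epsilon_{A'B'}e^{AA'}\otimes e^{BB'}$ ($\epsilon$ the skew $2\times2$ symbols), and $h$ is its projective inverse: with $U$ the unique vector field with $\theta(U)=1$, $h^{-1}(U,\cdot)=0$, $h$ is the unique solution of $h^{ab}h_{bc}=\delta^a_c-U^a\theta_c$, $h(\theta,\cdot)=0$.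 $\Lambda$-connections: torsion-free connections with Christoffel symbols given by $\Gamma^a_{\ bc}\partial_aw^\mu|=\partial_b\partial_cw^\mu|+\sigma^\mu_{\ \nu\rho}\,\partial_bw^\nu|\,\partial_cw^\rho|$, where $\{\sigma,\hat\sigma\}$ is, for each $x$, any pair, holomorphic in $\lambda\in U$ and $\hat\lambda\in\hat U$ respectively and symmetric in the lower indices, solving $\mathcal F^\mu_{\ \alpha\beta}=-\hat\sigma^\mu_{\ \nu\rho}\mathcal F^\nu_{\ \alpha}\mathcal F^\rho_{\ \beta}+\mathcal F^\mu_{\ \eta}\sigma^\eta_{\ \alpha\beta}$. The induced Newton-Cartan spacetimes are those in which, for some frame section $v=H^{-1}dw|=(\theta,\ e^{A1'}+e^{A0'}\lambda)$, the clock $\theta$ is the first component of $v$ and $h$ is the projective inverse (with respect to $\theta$) of $h^{-1}=\epsilon_{AB}\epsilon_{A'B'}e^{AA'}\otimes e^{BB'}$, and in which $\nabla$ is a $\Lambda$-connection satisfying $\nabla\theta=0$ and $\nabla h=0$. The conformal factor is the resulting non-vanishing function of $t$ relating $h$ to $\epsilon^{AB}\epsilon^{A'B'}\frac{\partial}{\partial x^{AA'}}\otimes\frac{\partial}{\partial x^{BB'}}$. *)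

theory Defs
  imports "HOL-Analysis.Determinants" "HOL-Analysis.Complex_Analysis_Basics"
begin

text \<open>
  Spinor indices \<open>A\<close>, \<open>A'\<close> are the elements \<open>0\<close>, \<open>1\<close> of the type \<open>2\<close>.  A spatial index is a pair
  \<open>(A, A')\<close>, so that \<open>(0,0) = v\<close>, \<open>(0,1) = u\<close>, \<open>(1,0) = y\<close>, \<open>(1,1) = x\<close>.  In the index types of
  \<open>M\<close> (coordinates \<open>t\<close>, \<open>x\<^sup>A\<^sup>A\<^sup>'\<close>) and of the fibres of \<open>Z\<close> (coordinates \<open>T\<close>, \<open>\<Omega>\<^sup>A\<close>), \<open>None\<close> stands for
  \<open>t\<close> and \<open>T\<close> respectively.
\<close>

type_synonym spatial = "2 \<times> 2"
type_synonym coord = "spatial option"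
type_synonym fibre = "2 option"
type_synonym pt = "complex ^ coord"
type_synonym christoffel = "pt \<Rightarrow> coord \<Rightarrow> coord \<Rightarrow> coord \<Rightarrow> complex"

section \<open>Holomorphic functions of several variables\<close>

text \<open>Only used on open sets.\<close>

definition holo_on :: "(complex ^ 'n::finite) set \<Rightarrow> (complex ^ 'n \<Rightarrow> complex) \<Rightarrow> bool" where
  "holo_on S f \<longleftrightarrow>
     (\<forall>x\<in>S. \<exists>D. (f has_derivative D) (at x) \<and> (\<forall>c v. D (c *s v) = c * D v))"

definition pd :: "'n \<Rightarrow> (complex ^ 'n::finite \<Rightarrow> complex) \<Rightarrow> complex ^ 'n \<Rightarrow> complex" where
  "pd a f x = deriv (\<lambda>z. f (x + z *s axis a 1)) 0"

section \<open>The twistor space and its sections\<close>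

definition patch :: "complex \<Rightarrow> complex ^ fibre \<Rightarrow> complex ^ fibre" where
  "patch l w = (\<chi> \<mu>. case \<mu> of None \<Rightarrow> w $ None | Some A \<Rightarrow> inverse l * w $ Some A)"

definition global_sections :: "(complex \<Rightarrow> complex ^ fibre) set" where
  "global_sections = {s. (\<forall>\<mu>. (\<lambda>l. s l $ \<mu>) holomorphic_on UNIV) \<and>
     (\<exists>s'. (\<forall>\<mu>. (\<lambda>l. s' l $ \<mu>) holomorphic_on UNIV) \<and>
           (\<forall>l. l \<noteq> 0 \<longrightarrow> s' (inverse l) = patch l (s l)))}"

definition line :: "pt \<Rightarrow> complex \<Rightarrow> complex ^ fibre" where
  "line x l = (\<chi> \<mu>. case \<mu> of None \<Rightarrow> x $ None | Some A \<Rightarrow> x $ Some (A, 1) + x $ Some (A, 0) * l)"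

text \<open>
  The part of \<open>M\<close> lying over an open subset \<open>I\<close> of the time axis; \<open>M = \<complex>\<^sup>5\<close> itself is \<open>over UNIV\<close>.
  Proper subsets are needed because a change of time coordinate may exist only locally.
\<close>

definition over :: "complex set \<Rightarrow> pt set" where
  "over I = {x. x $ None \<in> I}"

definition patch1 :: "pt \<Rightarrow> complex \<Rightarrow> complex ^ fibre ^ fibre" where
  "patch1 x l = (\<chi> \<mu> \<nu>. pd \<nu> (\<lambda>w. patch l w $ \<mu>) (line x l))"

definition patch2 :: "pt \<Rightarrow> complex \<Rightarrow> fibre \<Rightarrow> fibre \<Rightarrow> fibre \<Rightarrow> complex" where
  "patch2 x l \<mu> \<nu> \<rho> = pd \<nu> (pd \<rho> (\<lambda>w. patch l w $ \<mu>)) (line x l)"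

section \<open>Frame and metric\<close>

definition model_patch :: "complex \<Rightarrow> complex ^ fibre ^ fibre" where
  "model_patch l =
     (\<chi> \<mu> \<nu>. if \<mu> = \<nu> then (case \<mu> of None \<Rightarrow> 1 | Some A \<Rightarrow> inverse l) else 0)"

definition splitting ::
  "complex set \<Rightarrow> (pt \<Rightarrow> complex \<Rightarrow> complex ^ fibre ^ fibre) \<Rightarrow>
     (pt \<Rightarrow> complex \<Rightarrow> complex ^ fibre ^ fibre) \<Rightarrow> bool" where
  "splitting I H H' \<longleftrightarrow>
     (\<forall>x\<in>over I.
        (\<forall>\<mu> \<nu>. (\<lambda>l. H x l $ \<mu> $ \<nu>) holomorphic_on UNIV \<and> (\<lambda>l. H' x l $ \<mu> $ \<nu>) holomorphic_on UNIV) \<and>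
        (\<forall>l. invertible (H x l) \<and> invertible (H' x l)) \<and>
        (\<forall>l. l \<noteq> 0 \<longrightarrow> patch1 x l = H' x (inverse l) ** model_patch l ** matrix_inv (H x l))) \<and>
     (\<forall>l \<mu> \<nu>. holo_on (over I) (\<lambda>x. H x l $ \<mu> $ \<nu>) \<and> holo_on (over I) (\<lambda>x. H' x l $ \<mu> $ \<nu>))"

definition line_diff :: "pt \<Rightarrow> complex \<Rightarrow> complex ^ coord ^ fibre" where
  "line_diff x l = (\<chi> \<mu> a. pd a (\<lambda>y. line y l $ \<mu>) x)"

text \<open>The rows of the frame section \<open>H\<^sup>-\<^sup>1 dw|\<close> are one-forms on \<open>M\<close>.\<close>

definition frame_section ::
  "(pt \<Rightarrow> complex \<Rightarrow> complex ^ fibre ^ fibre) \<Rightarrow> pt \<Rightarrow> complex \<Rightarrow> complex ^ coord ^ fibre" where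
  "frame_section H x l = matrix_inv (H x l) ** line_diff x l"

definition frame_components ::
  "complex set \<Rightarrow> (pt \<Rightarrow> complex \<Rightarrow> complex ^ fibre ^ fibre) \<Rightarrow>
     (pt \<Rightarrow> complex ^ coord) \<Rightarrow> (pt \<Rightarrow> spatial \<Rightarrow> complex ^ coord) \<Rightarrow> bool" where
  "frame_components I H \<theta> e \<longleftrightarrow>
     (\<forall>x\<in>over I. \<forall>l. frame_section H x l $ None = \<theta> x \<and>
        (\<forall>A. frame_section H x l $ Some A = e x (A, 1) + l *s e x (A, 0)))"

definition eps :: "2 \<Rightarrow> 2 \<Rightarrow> complex" where
  "eps A B = (if A = 0 \<and> B = 1 then 1 else if A = 1 \<and> B = 0 then - 1 else 0)"

text \<open>
  The flat spatial metric \<open>\<epsilon>\<^sub>A\<^sub>B \<epsilon>\<^sub>A\<^sub>'\<^sub>B\<^sub>'\<close>; its inverse \<open>\<epsilon>\<^sup>A\<^sup>B \<epsilon>\<^sup>A\<^sup>'\<^sup>B\<^sup>'\<close> has the same components.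
\<close>

definition flat :: "spatial \<Rightarrow> spatial \<Rightarrow> complex" where
  "flat i j = eps (fst i) (fst j) * eps (snd i) (snd j)"

definition degenerate_metric :: "(spatial \<Rightarrow> complex ^ coord) \<Rightarrow> complex ^ coord ^ coord" where
  "degenerate_metric e = (\<chi> a b. \<Sum>i\<in>UNIV. \<Sum>j\<in>UNIV. flat i j * e i $ a * e j $ b)"

definition clock_dual ::
  "complex ^ coord \<Rightarrow> complex ^ coord ^ coord \<Rightarrow> complex ^ coord \<Rightarrow> bool" where
  "clock_dual \<theta> g U \<longleftrightarrow> (\<Sum>a\<in>UNIV. \<theta> $ a * U $ a) = 1 \<and> g *v U = 0"

text \<open>
  The contraction of \<open>h\<close> with \<open>\<theta>\<close> is on the index that the first equation contracts with \<open>g\<close>, so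
  that \<open>h\<close> is determined, and its symmetry is a consequence.
\<close>

definition projective_inverse ::
  "complex ^ coord \<Rightarrow> complex ^ coord ^ coord \<Rightarrow> complex ^ coord ^ coord \<Rightarrow> bool" where
  "projective_inverse \<theta> g h \<longleftrightarrow>
     (\<exists>U. clock_dual \<theta> g U \<and> (\<forall>U'. clock_dual \<theta> g U' \<longrightarrow> U' = U) \<and>
        h ** g = mat 1 - (\<chi> a c. U $ a * \<theta> $ c) \<and> h *v \<theta> = 0)"

section \<open>Connections\<close>

definition torsion_free :: "pt set \<Rightarrow> christoffel \<Rightarrow> bool" where
  "torsion_free S \<Gamma> \<longleftrightarrow> (\<forall>x\<in>S. \<forall>a b c. \<Gamma> x a b c = \<Gamma> x a c b)"

definition clock_parallel :: "pt set \<Rightarrow> (pt \<Rightarrow> complex ^ coord) \<Rightarrow> christoffel \<Rightarrow> bool" where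
  "clock_parallel S \<theta> \<Gamma> \<longleftrightarrow>
     (\<forall>x\<in>S. \<forall>b c. pd b (\<lambda>y. \<theta> y $ c) x - (\<Sum>a\<in>UNIV. \<Gamma> x a b c * \<theta> x $ a) = 0)"

definition metric_parallel :: "pt set \<Rightarrow> (pt \<Rightarrow> complex ^ coord ^ coord) \<Rightarrow> christoffel \<Rightarrow> bool" where
  "metric_parallel S h \<Gamma> \<longleftrightarrow>
     (\<forall>x\<in>S. \<forall>a b c. pd c (\<lambda>y. h y $ a $ b) x
        + (\<Sum>d\<in>UNIV. \<Gamma> x a c d * h x $ d $ b) + (\<Sum>d\<in>UNIV. \<Gamma> x b c d * h x $ a $ d) = 0)"

definition lambda_connection :: "complex set \<Rightarrow> christoffel \<Rightarrow> bool" where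
  "lambda_connection I \<Gamma> \<longleftrightarrow> torsion_free (over I) \<Gamma> \<and>
     (\<exists>(\<sigma> :: pt \<Rightarrow> complex \<Rightarrow> fibre \<Rightarrow> fibre \<Rightarrow> fibre \<Rightarrow> complex)
       (\<sigma>' :: pt \<Rightarrow> complex \<Rightarrow> fibre \<Rightarrow> fibre \<Rightarrow> fibre \<Rightarrow> complex).
        (\<forall>\<mu> \<nu> \<rho>.
           (\<forall>x\<in>over I. (\<lambda>l. \<sigma> x l \<mu> \<nu> \<rho>) holomorphic_on UNIV \<and> (\<lambda>l. \<sigma>' x l \<mu> \<nu> \<rho>) holomorphic_on UNIV) \<and>
           (\<forall>l. holo_on (over I) (\<lambda>x. \<sigma> x l \<mu> \<nu> \<rho>) \<and> holo_on (over I) (\<lambda>x. \<sigma>' x l \<mu> \<nu> \<rho>)) \<and>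
           (\<forall>x\<in>over I. \<forall>l. \<sigma> x l \<mu> \<nu> \<rho> = \<sigma> x l \<mu> \<rho> \<nu> \<and> \<sigma>' x l \<mu> \<nu> \<rho> = \<sigma>' x l \<mu> \<rho> \<nu>)) \<and>
        (\<forall>x\<in>over I. \<forall>l \<mu> \<alpha> \<beta>. l \<noteq> 0 \<longrightarrow>
           patch2 x l \<mu> \<alpha> \<beta> =
             - (\<Sum>\<nu>\<in>UNIV. \<Sum>\<rho>\<in>UNIV. \<sigma>' x (inverse l) \<mu> \<nu> \<rho> * patch1 x l $ \<nu> $ \<alpha> * patch1 x l $ \<rho> $ \<beta>)
             + (\<Sum>\<eta>\<in>UNIV. patch1 x l $ \<mu> $ \<eta> * \<sigma> x l \<eta> \<alpha> \<beta>)) \<and>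
        (\<forall>x\<in>over I. \<forall>l \<mu> b c.
           (\<Sum>a\<in>UNIV. \<Gamma> x a b c * line_diff x l $ \<mu> $ a) =
             pd b (pd c (\<lambda>y. line y l $ \<mu>)) x
             + (\<Sum>\<nu>\<in>UNIV. \<Sum>\<rho>\<in>UNIV. \<sigma> x l \<mu> \<nu> \<rho> * line_diff x l $ \<nu> $ b * line_diff x l $ \<rho> $ c)))"

section \<open>Newton-Cartan spacetimes\<close>

definition newton_cartan ::
  "complex set \<Rightarrow> (pt \<Rightarrow> complex ^ coord) \<Rightarrow> (pt \<Rightarrow> complex ^ coord ^ coord) \<Rightarrow> christoffel \<Rightarrow> bool"
  where
  "newton_cartan I \<theta> h \<Gamma> \<longleftrightarrow>
     (\<forall>a. holo_on (over I) (\<lambda>x. \<theta> x $ a)) \<and>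
     (\<forall>a b. holo_on (over I) (\<lambda>x. h x $ a $ b)) \<and>
     (\<forall>a b c. holo_on (over I) (\<lambda>x. \<Gamma> x a b c)) \<and>
     (\<forall>x\<in>over I. transpose (h x) = h x \<and> rank (h x) = 4) \<and>
     (\<forall>x\<in>over I. \<forall>a b. pd a (\<lambda>y. \<theta> y $ b) x = pd b (\<lambda>y. \<theta> y $ a) x) \<and>
     (\<forall>x\<in>over I. {\<alpha>. h x *v \<alpha> = 0} = vec.span {\<theta> x}) \<and>
     torsion_free (over I) \<Gamma> \<and> metric_parallel (over I) h \<Gamma> \<and> clock_parallel (over I) \<theta> \<Gamma>"

definition induced ::
  "complex set \<Rightarrow> (pt \<Rightarrow> complex ^ coord) \<Rightarrow> (pt \<Rightarrow> complex ^ coord ^ coord) \<Rightarrow> christoffel \<Rightarrow> bool"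
  where
  "induced I \<theta> h \<Gamma> \<longleftrightarrow>
     (\<exists>H H' e. splitting I H H' \<and> frame_components I H \<theta> e \<and>
        (\<forall>x\<in>over I. projective_inverse (\<theta> x) (degenerate_metric (e x)) (h x))) \<and>
     lambda_connection I \<Gamma> \<and> clock_parallel (over I) \<theta> \<Gamma> \<and> metric_parallel (over I) h \<Gamma>"

section \<open>Conformal factor, gravitational force and Coriolis two-form\<close>

definition conformal_factor ::
  "complex set \<Rightarrow> (pt \<Rightarrow> complex ^ coord ^ coord) \<Rightarrow> (complex \<Rightarrow> complex) \<Rightarrow> bool" where
  "conformal_factor I h f \<longleftrightarrow> f holomorphic_on I \<and> (\<forall>t\<in>I. f t \<noteq> 0) \<and>
     (\<forall>x\<in>over I. \<forall>a b. h x $ a $ b =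
        (case (a, b) of (Some i, Some j) \<Rightarrow> f (x $ None) * flat i j | _ \<Rightarrow> 0))"

definition spatial_metric :: "complex ^ coord ^ coord \<Rightarrow> complex ^ spatial ^ spatial" where
  "spatial_metric h = matrix_inv (\<chi> i j. h $ Some i $ Some j)"

definition gravitational_force :: "christoffel \<Rightarrow> pt \<Rightarrow> complex ^ spatial" where
  "gravitational_force \<Gamma> x = (\<chi> i. \<Gamma> x (Some i) None None)"

text \<open>The trace-free part of \<open>\<Gamma>\<^sup>i\<^sub>j\<^sub>t\<close>, with \<open>i\<close> lowered.\<close>

definition coriolis ::
  "(pt \<Rightarrow> complex ^ coord ^ coord) \<Rightarrow> christoffel \<Rightarrow> pt \<Rightarrow> complex ^ spatial ^ spatial" where
  "coriolis h \<Gamma> x = (\<chi> i j. \<Sum>k\<in>UNIV. spatial_metric (h x) $ i $ k *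
     (\<Gamma> x (Some k) (Some j) None
        - (if k = j then (\<Sum>l\<in>UNIV. \<Gamma> x (Some l) (Some l) None) / 4 else 0)))"

text \<open>
  Components of \<open>dx \<and> dy \<and> dv \<and> du\<close>: the determinant of the matrix whose rows, labelled by
  \<open>x, y, v, u\<close>, are the basis vectors \<open>\<partial>\<^sub>i, \<partial>\<^sub>j, \<partial>\<^sub>k, \<partial>\<^sub>l\<close>.  It is the metric volume form of \<open>flat\<close>.
\<close>

definition vol :: "spatial \<Rightarrow> spatial \<Rightarrow> spatial \<Rightarrow> spatial \<Rightarrow> complex" where
  "vol i j k l = det (\<chi> p. axis (if p = (1, 1) then i else if p = (1, 0) then j
                               else if p = (0, 0) then k else l) 1 :: complex ^ spatial ^ spatial)"

text \<open>
  On two-forms in four dimensions the Hodge star is conformally invariant, so it may be taken with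
  respect to \<open>flat\<close> rather than a multiple of it.
\<close>

definition hodge :: "complex ^ spatial ^ spatial \<Rightarrow> complex ^ spatial ^ spatial" where
  "hodge W = (\<chi> i j. (\<Sum>k\<in>UNIV. \<Sum>l\<in>UNIV. \<Sum>m\<in>UNIV. \<Sum>n\<in>UNIV.
     vol i j k l * flat k m * flat l n * W $ m $ n) / 2)"

definition anti_self_dual :: "complex ^ spatial ^ spatial \<Rightarrow> bool" where
  "anti_self_dual W \<longleftrightarrow> transpose W = - W \<and> hodge W = - W"

text \<open>
  The connection determined by a clock \<open>m dt\<close>, a conformal factor \<open>f\<close>, a force \<open>F\<close> and a Coriolis
  form \<open>W\<close>, the first index of \<open>W\<close> being raised with \<open>h\<^sup>i\<^sup>j = f \<epsilon>\<^sup>A\<^sup>B \<epsilon>\<^sup>A\<^sup>'\<^sup>B\<^sup>'\<close>.  The function \<open>m\<close> is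
  the freedom in the choice of the time coordinate; \<open>m = 1\<close> if the clock is \<open>dt\<close>.
\<close>

definition nc_mixed ::
  "(complex \<Rightarrow> complex) \<Rightarrow> (pt \<Rightarrow> complex ^ spatial ^ spatial) \<Rightarrow>
     pt \<Rightarrow> spatial \<Rightarrow> spatial \<Rightarrow> complex" where
  "nc_mixed f W x i j =
     (if i = j then - deriv f (x $ None) / (2 * f (x $ None)) else 0)
     + (\<Sum>k\<in>UNIV. f (x $ None) * flat i k * W x $ k $ j)"

definition nc_connection ::
  "(complex \<Rightarrow> complex) \<Rightarrow> (complex \<Rightarrow> complex) \<Rightarrow> (pt \<Rightarrow> complex ^ spatial) \<Rightarrow>
     (pt \<Rightarrow> complex ^ spatial ^ spatial) \<Rightarrow> christoffel" where
  "nc_connection m f F W x a b c =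
     (case (a, b, c) of
        (None, None, None) \<Rightarrow> deriv m (x $ None) / m (x $ None)
      | (Some i, None, None) \<Rightarrow> F x $ i
      | (Some i, Some j, None) \<Rightarrow> nc_mixed f W x i j
      | (Some i, None, Some j) \<Rightarrow> nc_mixed f W x i j
      | _ \<Rightarrow> 0)"

section \<open>Diffeomorphisms\<close>

definition time_map :: "(complex \<Rightarrow> complex) \<Rightarrow> pt \<Rightarrow> pt" where
  "time_map \<tau> x = (\<chi> a. case a of None \<Rightarrow> \<tau> (x $ None) | Some i \<Rightarrow> x $ Some i)"

text \<open>\<open>\<theta>\<close> and \<open>\<Gamma>\<close> are the pullbacks of \<open>\<theta>'\<close> and \<open>\<Gamma>'\<close> by \<open>\<phi>\<close>, and \<open>h'\<close> is the push-forward of \<open>h\<close>.\<close>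

definition carries ::
  "pt set \<Rightarrow> (pt \<Rightarrow> pt) \<Rightarrow>
     (pt \<Rightarrow> complex ^ coord) \<Rightarrow> (pt \<Rightarrow> complex ^ coord ^ coord) \<Rightarrow> christoffel \<Rightarrow>
     (pt \<Rightarrow> complex ^ coord) \<Rightarrow> (pt \<Rightarrow> complex ^ coord ^ coord) \<Rightarrow> christoffel \<Rightarrow> bool" where
  "carries S \<phi> \<theta> h \<Gamma> \<theta>' h' \<Gamma>' \<longleftrightarrow>
     (\<forall>x\<in>S. let J = (\<lambda>d a. pd a (\<lambda>y. \<phi> y $ d) x) in
        (\<forall>a. \<theta> x $ a = (\<Sum>d\<in>UNIV. \<theta>' (\<phi> x) $ d * J d a)) \<and>
        (\<forall>d e. h' (\<phi> x) $ d $ e = (\<Sum>a\<in>UNIV. \<Sum>b\<in>UNIV. h x $ a $ b * J d a * J e b)) \<and>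
        (\<forall>d b c. (\<Sum>a\<in>UNIV. \<Gamma> x a b c * J d a) =
           pd b (pd c (\<lambda>y. \<phi> y $ d)) x
           + (\<Sum>e\<in>UNIV. \<Sum>g\<in>UNIV. \<Gamma>' (\<phi> x) d e g * J e b * J g c)))"

end

theory Submission
  imports Defs "HOL-Complex_Analysis.Conformal_Mappings"
begin

text \<open>
  By Liouville's theorem each entry of the splitting matrix \<open>H\<close> and each component of \<open>\<sigma>\<close> is an
  entire function of \<open>\<lambda>\<close> bounded by a power of \<open>\<lambda>\<close>, namely a global section of \<open>\<O>(-k)\<close> (zero), \<open>\<O>\<close>
  (constant) or \<open>\<O>(1)\<close> (affine).  Hence \<open>\<theta>\<close> is a multiple of \<open>dt\<close>, \<open>h\<close> is a multiple of the flat metric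
  by the determinant of the \<open>\<O>(1) \<oplus> \<O>(1)\<close> block of \<open>H\<close>, the force \<open>\<Gamma>\<^sup>i\<^sub>t\<^sub>t\<close> is free because it comes from
  sections of \<open>\<O>(1)\<close>, and \<open>\<Gamma>\<^sup>i\<^sub>j\<^sub>t\<close> is a \<open>2 \<times> 2\<close> matrix in the unprimed indices tensored with \<open>\<delta>\<close> in the
  primed ones.  Parallelism of \<open>\<theta>\<close> and \<open>h\<close> forces both factors to depend on \<open>t\<close> only and fixes the trace
  of that matrix; the trace-free part, lowered, has the form \<open>\<phi>\<^sub>A\<^sub>B \<epsilon>\<^sub>A\<^sub>'\<^sub>B\<^sub>'\<close> with \<open>\<phi>\<close> symmetric, which is
  anti-self-duality.  A primitive of the clock component is a local time coordinate with \<open>\<theta> = dt\<close>.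
\<close>

section \<open>Finite index types\<close>

text \<open>The patching is linear, so components decouple: entry \<mu>, \<nu> of \<open>H\<close>
  is a section of O(d_\<mu> - d_\<nu>), and component \<mu>, \<nu>, \<rho> of \<sigma> a section of
  O(d_\<mu> - d_\<nu> - d_\<rho>), with d = 0 for \<open>None\<close> and d = 1 for
  \<open>Some A\<close>. Every vanishing or constancy result is read off these degrees. The entries
  of \<open>H\<close> in O(1) mix \<theta> into the forms e^{AA'}, but alter only their dt
  components, to which \<open>h\<close> is blind because it annihilates \<theta>. Write S for the
  2x2 matrix in the mixed components. Since S eps + eps S^T = (tr S) eps, the time component of the
  parallelism of \<open>h\<close> is the single equation tr S = - f'/f, and the three trace-free
  entries of S stay free. As \<open>I\<close> may be any open set, the constructions must be global
  on \<open>I\<close> or explicitly local. The spatial fibres are full copies of C^4, so constancy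
  along them yields dependence on t alone; a frame realising \<open>f\<close> has to avoid a square
  root of \<open>f\<close>; and a time coordinate is built on a small disc only.\<close>

lemma two_cases: "A = 0 \<or> A = (1::2)"
  using exhaust_2[of A] by auto

lemma all_two: "(\<forall>A::2. P A) \<longleftrightarrow> P 0 \<and> P 1"
  using two_cases by metis

lemma sum_two: "(\<Sum>A\<in>UNIV. g (A::2)) = g 0 + (g 1 :: 'a::comm_monoid_add)"
proof -
  have "(UNIV :: 2 set) = {0, 1}" using two_cases by auto
  then show ?thesis unfolding \<open>UNIV = {0, 1}\<close> by simp
qed

lemma sum_spatial: "(\<Sum>i\<in>UNIV. g (i::spatial)) =
    g (0, 0) + g (0, 1) + (g (1, 0) + (g (1, 1) :: 'a::comm_monoid_add))"
proof -
  have "(\<Sum>i\<in>UNIV. g i) = (\<Sum>A\<in>UNIV. \<Sum>B\<in>UNIV. g (A, B))"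
    by (simp add: sum.cartesian_product)
  then show ?thesis by (simp add: sum_two)
qed

lemma sum_option:
  "(\<Sum>a\<in>UNIV. g (a :: 'n::finite option)) = g None + (\<Sum>i\<in>UNIV. (g (Some i) :: 'a::comm_monoid_add))"
proof -
  have "(\<Sum>a\<in>UNIV. g a) = g None + (\<Sum>a\<in>range Some. g a)"
    by (simp add: UNIV_option_conv)
  then show ?thesis by (simp add: sum.reindex)
qed

lemma all_option: "(\<forall>a. P a) \<longleftrightarrow> P None \<and> (\<forall>i. P (Some i))"
  by (metis option.exhaust)

lemma eps_simps [simp]:
  "eps 0 0 = 0" "eps 0 1 = 1" "eps 1 0 = - 1" "eps 1 1 = 0"
  by (auto simp: eps_def)

lemma flat_sym: "flat i j = flat j i"
  by (auto simp: flat_def eps_def)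

text \<open>\<open>eps\<close> squares to minus the identity, and the two minus signs cancel. Being
  its own inverse, \<open>flat\<close> serves for both lowering and raising.\<close>

lemma flat_flat: "(\<Sum>k\<in>UNIV. flat i k * flat k j) = (if i = j then 1 else 0)"
proof -
  have "\<forall>i j. (\<Sum>k\<in>UNIV. flat i k * flat k j) = (if i = j then 1 else 0)"
    by (simp add: all_two sum_spatial flat_def)
  then show ?thesis by blast
qed

section \<open>Partial derivatives and holomorphic functions of several variables\<close>

lemma open_over: "open I \<Longrightarrow> open (over I)"
  unfolding over_def using open_vimage_vec_nth[of I None] by (simp add: vimage_def)

lemma pd_eqI:
  "((\<lambda>z. f (x + z *s axis a 1)) has_field_derivative D) (at 0) \<Longrightarrow> pd a f x = D"
  unfolding pd_def by (rule DERIV_imp_deriv)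

lemma pd_const [simp]: "pd a (\<lambda>y. c) x = 0"
  by (simp add: pd_def)

text \<open>A short complex segment through \<open>x\<close> stays in the open set, so
  \<open>pd\<close> at \<open>x\<close> sees nearby values only. The geometry is constrained on
  \<open>over I\<close> alone, so its formulas may be differentiated only in this way.\<close>

lemma pd_transform:
  assumes "open S" "x \<in> S" "\<And>y. y \<in> S \<Longrightarrow> f y = g y"
  shows "pd a f x = pd a g x"
proof -
  have "(\<lambda>z::complex. x + z *s axis a 1) \<midarrow>0\<rightarrow> x + 0 *s axis a 1"
    by (intro vec_tendstoI) (auto intro!: tendsto_eq_intros)
  then have "\<forall>\<^sub>F z in nhds 0. x + z *s axis a 1 \<in> S"
    using assms(1,2) by (auto simp: tendsto_def eventually_at_filter elim!: allE[of _ S] eventually_mono)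
  then have "\<forall>\<^sub>F z in nhds 0. f (x + z *s axis a 1) = g (x + z *s axis a 1)"
    by eventually_elim (use assms(3) in auto)
  then show ?thesis
    unfolding pd_def by (intro deriv_cong_ev) auto
qed

lemma pd_nth: "pd a (\<lambda>y. y $ b) x = (if a = b then 1 else 0)"
  by (rule pd_eqI) (auto simp: axis_def intro!: derivative_eq_intros)

lemma pd_time:
  assumes "(g has_field_derivative d) (at (x $ None))"
  shows "pd a (\<lambda>y. g (y $ None)) x = (if a = None then d else 0)"
proof (rule pd_eqI)
  have "((\<lambda>z. g (x $ None + z)) has_field_derivative d) (at 0)"
    using assms DERIV_at_within_shift[of g d "x $ None" 0 UNIV] by simp
  then show "((\<lambda>z. g ((x + z *s axis a 1) $ None)) has_field_derivative (if a = None then d else 0)) (at 0)"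
    by (auto simp: axis_def)
qed

lemma linear_sum_axis:
  fixes D :: "complex ^ 'n::finite \<Rightarrow> complex"
  assumes "linear D" "\<And>c v. D (c *s v) = c * D v"
  shows "D v = (\<Sum>a\<in>UNIV. v $ a * D (axis a 1))"
proof -
  have "v = (\<Sum>a\<in>UNIV. (v $ a) *s axis a 1)"
    by (simp add: basis_expansion)
  then have "D v = (\<Sum>a\<in>UNIV. D ((v $ a) *s axis a 1))"
    using linear_sum[OF assms(1)] by metis
  then show ?thesis by (simp add: assms(2))
qed

text \<open>The Frechet derivative is real linear; homogeneity of \<open>D\<close> under complex
  scalars makes the restriction to a complex line complex differentiable.\<close>

lemma has_derivative_line:
  fixes f :: "complex ^ 'n::finite \<Rightarrow> complex"
  assumes "(f has_derivative D) (at (x + z *s v))" "\<And>c v. D (c *s v) = c * D v"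
  shows "((\<lambda>z. f (x + z *s v)) has_field_derivative D v) (at z)"
proof -
  have "((\<lambda>z. x + z *s v) has_derivative (\<lambda>z. z *s v)) (at z)"
  proof -
    have "bounded_linear (\<lambda>z::complex. z *s v)"
      by (intro linear_conv_bounded_linear[THEN iffD1] linearI)
         (auto simp: vec_eq_iff algebra_simps)
    then have "((\<lambda>z. z *s v) has_derivative (\<lambda>z. z *s v)) (at z)"
      by (rule bounded_linear_imp_has_derivative)
    from has_derivative_add[OF has_derivative_const this, of x] show ?thesis by simp
  qed
  from diff_chain_at[OF this assms(1)] have "((\<lambda>z. f (x + z *s v)) has_derivative (\<lambda>z. D (z *s v))) (at z)"
    by (simp add: o_def)
  then show ?thesis
    by (simp add: has_field_derivative_def assms(2) mult.commute[of _ "D v"])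
qed

lemma holo_onE:
  assumes "holo_on S f" "x \<in> S"
  obtains D where "(f has_derivative D) (at x)" "\<And>c v. D (c *s v) = c * D v"
    "\<And>a. D (axis a 1) = pd a f x"
proof -
  from assms obtain D where D: "(f has_derivative D) (at x)" "\<And>c v. D (c *s v) = c * D v"
    unfolding holo_on_def by blast
  moreover have "D (axis a 1) = pd a f x" for a
    using has_derivative_line[of f D x 0 "axis a 1"] D by (simp add: pd_eqI)
  ultimately show ?thesis using that by blast
qed

lemma holo_on_pd:
  assumes "holo_on S f" "x \<in> S"
  shows "((\<lambda>z. f (x + z *s axis a 1)) has_field_derivative pd a f x) (at 0)"
proof -
  obtain D where D: "(f has_derivative D) (at x)" "\<And>c v. D (c *s v) = c * D v"
    "\<And>a. D (axis a 1) = pd a f x"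
    using holo_onE[OF assms] by metis
  show ?thesis
    using has_derivative_line[of f D x 0 "axis a 1"] D by simp
qed

lemma holo_on_const [intro]: "holo_on S (\<lambda>x. c)"
  unfolding holo_on_def by (auto intro!: exI[of _ "\<lambda>_. 0"])

lemma holo_on_add [intro]:
  assumes "holo_on S f" "holo_on S g"
  shows "holo_on S (\<lambda>x. f x + g x)"
  unfolding holo_on_def
proof
  fix x assume "x \<in> S"
  with assms obtain D E where "(f has_derivative D) (at x)" "\<forall>c v. D (c *s v) = c * D v"
    "(g has_derivative E) (at x)" "\<forall>c v. E (c *s v) = c * E v"
    unfolding holo_on_def by blast
  then show "\<exists>D. ((\<lambda>x. f x + g x) has_derivative D) (at x) \<and> (\<forall>c v. D (c *s v) = c * D v)"
    by (intro exI[of _ "\<lambda>h. D h + E h"]) (auto intro!: derivative_intros simp: algebra_simps)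
qed

lemma holo_on_mult [intro]:
  assumes "holo_on S f" "holo_on S g"
  shows "holo_on S (\<lambda>x. f x * g x)"
  unfolding holo_on_def
proof
  fix x assume "x \<in> S"
  with assms obtain D E where "(f has_derivative D) (at x)" "\<forall>c v. D (c *s v) = c * D v"
    "(g has_derivative E) (at x)" "\<forall>c v. E (c *s v) = c * E v"
    unfolding holo_on_def by blast
  then show "\<exists>D. ((\<lambda>x. f x * g x) has_derivative D) (at x) \<and> (\<forall>c v. D (c *s v) = c * D v)"
    using has_derivative_mult[of f D x UNIV g E]
    by (intro exI[of _ "\<lambda>h. f x * E h + D h * g x"]) (auto simp: algebra_simps)
qed

lemma holo_on_uminus [intro]: "holo_on S f \<Longrightarrow> holo_on S (\<lambda>x. - f x)"
  using holo_on_mult[OF holo_on_const[of S "- 1"]] by simp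

lemma holo_on_diff [intro]: "holo_on S f \<Longrightarrow> holo_on S g \<Longrightarrow> holo_on S (\<lambda>x. f x - g x)"
  using holo_on_add[OF _ holo_on_uminus, of S f g] by simp

lemma holo_on_sum [intro]:
  "(\<And>k. k \<in> A \<Longrightarrow> holo_on S (f k)) \<Longrightarrow> holo_on S (\<lambda>x. \<Sum>k\<in>A. f k x)"
  by (induction A rule: infinite_finite_induct) auto

lemma holo_on_compose:
  assumes "holo_on S p" "g holomorphic_on T" "open T" "\<And>x. x \<in> S \<Longrightarrow> p x \<in> T"
  shows "holo_on S (\<lambda>x. g (p x))"
  unfolding holo_on_def
proof
  fix x assume x: "x \<in> S"
  with assms(1) obtain D where D: "(p has_derivative D) (at x)" "\<forall>c v. D (c *s v) = c * D v"
    unfolding holo_on_def by blast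
  have "(g has_derivative (\<lambda>h. deriv g (p x) * h)) (at (p x))"
    using holomorphic_derivI[OF assms(2,3,4)] x by (simp add: has_field_derivative_def)
  with D have "((\<lambda>x. g (p x)) has_derivative (\<lambda>h. deriv g (p x) * D h)) (at x)"
    using has_derivative_compose[of p D x UNIV g] by simp
  with D show "\<exists>D. ((\<lambda>x. g (p x)) has_derivative D) (at x) \<and> (\<forall>c v. D (c *s v) = c * D v)"
    by (intro exI[of _ "\<lambda>h. deriv g (p x) * D h"]) simp
qed

lemma holo_on_divide [intro]:
  assumes "holo_on S f" "holo_on S g" "\<And>x. x \<in> S \<Longrightarrow> g x \<noteq> 0"
  shows "holo_on S (\<lambda>x. f x / g x)"
proof -
  have "holo_on S (\<lambda>x. inverse (g x))"
    by (rule holo_on_compose[OF assms(2), of inverse "- {0}"])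
       (use assms(3) in \<open>auto intro!: holomorphic_intros\<close>)
  from holo_on_mult[OF assms(1) this] show ?thesis by (simp add: field_simps)
qed

lemma holo_on_nth [intro]: "holo_on S (\<lambda>x. x $ a)"
  unfolding holo_on_def
  by (intro ballI exI[of _ "\<lambda>v. v $ a"])
     (auto intro!: bounded_linear_imp_has_derivative bounded_linear_vec_nth)

lemma holo_on_time:
  assumes "g holomorphic_on I" "open I"
  shows "holo_on (over I) (\<lambda>x. g (x $ None))"
  by (rule holo_on_compose[OF holo_on_nth assms]) (auto simp: over_def)

lemma holo_on_transform:
  assumes "holo_on S f" "open S" "\<And>x. x \<in> S \<Longrightarrow> f x = g x"
  shows "holo_on S g"
  unfolding holo_on_def
proof
  fix x assume x: "x \<in> S"
  with assms(1) obtain D where "(f has_derivative D) (at x)" "\<forall>c v. D (c *s v) = c * D v"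
    unfolding holo_on_def by blast
  then show "\<exists>D. (g has_derivative D) (at x) \<and> (\<forall>c v. D (c *s v) = c * D v)"
    using has_derivative_transform_within_open[of f D x UNIV S g] assms x by auto
qed

text \<open>A section of the projection to the time axis: a function constant on the spatial fibres
  becomes a function of t by evaluation along it.\<close>

definition at_time :: "complex \<Rightarrow> pt" where
  "at_time t = t *s axis None 1"

lemma at_time_None [simp]: "at_time t $ None = t"
  by (simp add: at_time_def axis_def)

lemma at_time_over [simp]: "at_time t \<in> over I \<longleftrightarrow> t \<in> I"
  by (simp add: over_def)

lemma holomorphic_at_time:
  assumes "holo_on (over I) f" "t \<in> I"
  shows "((\<lambda>s. f (at_time s)) has_field_derivative pd None f (at_time t)) (at t)"
proof -
  have "((\<lambda>z. f (at_time t + z *s axis None 1)) has_field_derivative pd None f (at_time t)) (at 0)"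
    using assms by (intro holo_on_pd) auto
  then have "((\<lambda>z. f (at_time (t + z))) has_field_derivative pd None f (at_time t)) (at 0)"
    by (simp add: at_time_def vector_sadd_rdistrib)
  then show ?thesis
    using DERIV_at_within_shift[of "\<lambda>s. f (at_time s)" _ t 0 UNIV] by simp
qed

text \<open>The fibre over a fixed time is all of C^4, so the complex line from its base point
  through \<open>x\<close> stays in \<open>over I\<close>, and the derivative along that line is a
  combination of spatial partial derivatives.\<close>

lemma function_of_time:
  assumes "holo_on (over I) f" "\<And>x i. x \<in> over I \<Longrightarrow> pd (Some i) f x = 0" "x \<in> over I"
  shows "f x = f (at_time (x $ None))"
proof -
  define v where "v = x - at_time (x $ None)"
  have v: "v $ None = 0" by (simp add: v_def)
  have "((\<lambda>z. f (at_time (x $ None) + z *s v)) has_field_derivative 0) (at z)" for z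
  proof -
    have "at_time (x $ None) + z *s v \<in> over I"
      using assms(3) v by (simp add: over_def)
    then obtain D where D: "(f has_derivative D) (at (at_time (x $ None) + z *s v))"
      "\<And>c v. D (c *s v) = c * D v" "\<And>i. D (axis (Some i) 1) = 0"
      using holo_onE[OF assms(1)] assms(2) by metis
    have "D v = (\<Sum>a\<in>UNIV. v $ a * D (axis a 1))"
      using D by (intro linear_sum_axis has_derivative_linear)
    also have "\<dots> = 0" by (simp add: sum_option v D)
    finally show ?thesis using has_derivative_line[OF D(1,2)] by simp
  qed
  then have "f (at_time (x $ None) + 1 *s v) = f (at_time (x $ None) + 0 *s v)"
    using has_field_derivative_zero_constant[of UNIV "\<lambda>z. f (at_time (x $ None) + z *s v)"]
    by (metis convex_UNIV UNIV_I)
  then show ?thesis by (simp add: v_def)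
qed

section \<open>Sections of line bundles\<close>

text \<open>Sections of O: outside the unit disc \<open>f\<close> is bounded by the bound of
  \<open>g\<close> on the closed unit disc, so Liouville's theorem applies in degree 0.\<close>

lemma entire_const_if_patched:
  assumes "f holomorphic_on UNIV" "g holomorphic_on UNIV"
    "\<And>l. l \<noteq> 0 \<Longrightarrow> g (inverse l) = f l"
  shows "f l = f 0"
proof -
  have "bounded (g ` cball 0 1)"
    using assms(2) by (intro compact_imp_bounded compact_continuous_image
        holomorphic_on_imp_continuous_on) (auto intro: holomorphic_on_subset)
  then have "\<exists>B. \<forall>z\<in>cball 0 1. norm (g z) \<le> B"
    by (simp add: bounded_iff)
  then obtain B where B: "\<And>z. norm z \<le> 1 \<Longrightarrow> norm (g z) \<le> B"
    using mem_cball_0 by blast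
  have "f l = (\<Sum>k\<le>0. (deriv ^^ k) f 0 / fact k * l ^ k)"
  proof (rule Liouville_polynomial[OF assms(1), of 1 B])
    fix z :: complex assume "1 \<le> norm z"
    then have "z \<noteq> 0" "norm (inverse z) \<le> 1" by (auto simp: norm_inverse inverse_le_1_iff)
    with B assms(3) show "norm (f z) \<le> B * norm z ^ 0" by (metis power_0 mult_1_right)
  qed
  then show ?thesis by simp
qed

text \<open>Sections of O(-1): \<open>l * f l\<close> is a section of O vanishing at 0, hence zero.
  Division gives \<open>f\<close> away from 0 and continuity gives it at 0.\<close>

lemma entire_zero_if_patched:
  assumes "f holomorphic_on UNIV" "g holomorphic_on UNIV"
    "\<And>l. l \<noteq> 0 \<Longrightarrow> g (inverse l) = l * f l"
  shows "f l = 0"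
proof -
  have *: "l * f l = 0" for l
  proof -
    have "(\<lambda>l. l * f l) holomorphic_on UNIV"
      using assms(1) by (intro holomorphic_intros)
    from entire_const_if_patched[OF this assms(2,3), of l] show ?thesis by simp
  qed
  have "isCont f 0"
    using holomorphic_on_imp_continuous_on[OF assms(1)] by (simp add: continuous_on_eq_continuous_at)
  moreover have "f \<midarrow>0\<rightarrow> 0"
    using * by (intro tendsto_eventually) (auto simp: eventually_at_filter intro!: always_eventually)
  ultimately have "f 0 = 0" by (metis isContD LIM_unique)
  then show ?thesis using *[of l] by (cases "l = 0") auto
qed

text \<open>Sections of O(1): subtracting the value at 0 and dividing by \<open>l\<close> lowers the
  degree to 0, the singularity of the quotient at 0 being removable.\<close>

lemma entire_affine_if_patched:
  assumes "f holomorphic_on UNIV" "g holomorphic_on UNIV"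
    "\<And>l. l \<noteq> 0 \<Longrightarrow> g (inverse l) = inverse l * f l"
  shows "f l = f 0 + (f 1 - f 0) * l"
proof -
  define q where "q l = (if l = 0 then deriv f 0 else (f l - f 0) / (l - 0))" for l
  have "q holomorphic_on UNIV"
    unfolding q_def using pole_lemma[OF assms(1), of 0] by (simp add: if_distrib cong: if_cong)
  \<comment> \<open>The partner in the other chart comes from
    \<open>g (inverse l) - f 0 * inverse l = (f l - f 0) / l\<close>.\<close>
  then have "q l = q 0" for l
    by (rule entire_const_if_patched[of q "\<lambda>l. g l - f 0 * l"])
       (use assms in \<open>auto intro!: holomorphic_intros simp: q_def field_simps\<close>)
  from this[of l] this[of 1] show ?thesis
    by (cases "l = 0") (auto simp: q_def field_simps)
qed

lemma line_nth [simp]: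
  "line x l $ None = x $ None" "line x l $ Some A = x $ Some (A, 1) + x $ Some (A, 0) * l"
  by (simp_all add: line_def)

lemma bij_betw_line: "bij_betw line UNIV global_sections"
proof -
  have "inj line"
  proof (rule injI)
    fix x y assume "line x = line y"
    then have *: "line x l $ \<mu> = line y l $ \<mu>" for l \<mu> by simp
    from *[of 0 None] *[of 0 "Some _"] *[of 1 "Some _"]
    have "\<forall>a. x $ a = y $ a" by (auto simp: all_option all_two)
    then show "x = y" by (simp add: vec_eq_iff)
  qed
  moreover have "line x \<in> global_sections" for x
  proof -
    define s' :: "complex \<Rightarrow> complex ^ fibre" where "s' = (\<lambda>l. \<chi> \<mu>. case \<mu> of None \<Rightarrow> x $ None
      | Some A \<Rightarrow> x $ Some (A, 1) * l + x $ Some (A, 0))"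
    have "\<forall>\<mu>. (\<lambda>l. s' l $ \<mu>) holomorphic_on UNIV" "\<forall>\<mu>. (\<lambda>l. line x l $ \<mu>) holomorphic_on UNIV"
      by (auto simp: all_option s'_def intro!: holomorphic_intros)
    moreover have "s' (inverse l) = patch l (line x l)" if "l \<noteq> 0" for l
      using that by (simp add: vec_eq_iff all_option s'_def patch_def field_simps)
    ultimately show ?thesis unfolding global_sections_def by blast
  qed
  moreover have "s \<in> range line" if "s \<in> global_sections" for s
  proof -
    from that obtain s' where hol: "\<And>\<mu>. (\<lambda>l. s l $ \<mu>) holomorphic_on UNIV"
      "\<And>\<mu>. (\<lambda>l. s' l $ \<mu>) holomorphic_on UNIV"
      and p: "\<And>l. l \<noteq> 0 \<Longrightarrow> s' (inverse l) = patch l (s l)"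
      unfolding global_sections_def by blast
    have T: "s l $ None = s 0 $ None" for l
      by (rule entire_const_if_patched[OF hol(1) hol(2)[of None]]) (simp add: p patch_def)
    have \<Omega>: "s l $ Some A = s 0 $ Some A + (s 1 $ Some A - s 0 $ Some A) * l" for l A
      by (rule entire_affine_if_patched[OF hol(1) hol(2)[of "Some A"]]) (simp add: p patch_def)
    \<comment> \<open>Inverts \<open>line\<close>: the value at 0 is the coordinate (A, 1), and the
      slope, read off between 0 and 1, is the coordinate (A, 0).\<close>
    define x :: pt where "x = (\<chi> a. case a of None \<Rightarrow> s 0 $ None | Some i \<Rightarrow>
      if snd i = 1 then s 0 $ Some (fst i) else s 1 $ Some (fst i) - s 0 $ Some (fst i))"
    have "s l = line x l" for l
      using T[of l] \<Omega>[of l] by (simp add: vec_eq_iff all_option x_def)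
    then show ?thesis by blast
  qed
  ultimately show ?thesis unfolding bij_betw_def by blast
qed

section \<open>Anti-self-dual two-forms\<close>

text \<open>Exchanging neighbouring arguments exchanges two rows. Together with a single value this
  yields every component of \<open>vol\<close> by sorting, without expanding 4x4
  determinants.\<close>

lemma vol_swap:
  "vol j i k l = - vol i j k l" "vol i k j l = - vol i j k l" "vol i j l k = - vol i j k l"
proof -
  define A :: "complex ^ spatial ^ spatial" where "A = (\<chi> p. axis (if p = (1, 1) then i
    else if p = (1, 0) then j else if p = (0, 0) then k else l) 1)"
  have *: "det (\<chi> p. A $ Transposition.transpose a b p) = - det A" if "a \<noteq> b" for a b
    using that by (subst det_permute_rows) (auto simp: permutes_swap_id sign_swap_id)
  have A: "vol i j k l = det A" by (simp add: vol_def A_def)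
  have "vol j i k l = det (\<chi> p. A $ Transposition.transpose (1, 1) (1, 0) p)"
    unfolding vol_def A_def
    by (rule arg_cong[of _ _ det]) (simp add: vec_eq_iff all_two Transposition.transpose_def)
  then show "vol j i k l = - vol i j k l" by (simp add: * A)
  have "vol i k j l = det (\<chi> p. A $ Transposition.transpose (1, 0) (0, 0) p)"
    unfolding vol_def A_def
    by (rule arg_cong[of _ _ det]) (simp add: vec_eq_iff all_two Transposition.transpose_def)
  then show "vol i k j l = - vol i j k l" by (simp add: * A)
  have "vol i j l k = det (\<chi> p. A $ Transposition.transpose (0, 0) (0, 1) p)"
    unfolding vol_def A_def
    by (rule arg_cong[of _ _ det]) (simp add: vec_eq_iff all_two Transposition.transpose_def)
  then show "vol i j l k = - vol i j k l" by (simp add: * A)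
qed

lemma vol_eq_0: "vol i i k l = 0" "vol k i i l = 0" "vol k l i i = 0"
  using vol_swap(1)[of i i k l] vol_swap(2)[of k i i l] vol_swap(3)[of k l i i] by auto

text \<open>The order v, u, y, x; its only purpose is to direct the sorting of the arguments of
  \<open>vol\<close>.\<close>

definition spatial_number :: "spatial \<Rightarrow> nat" where
  "spatial_number i = (if fst i = 0 then 0 else 2) + (if snd i = 0 then 0 else 1)"

text \<open>The premises orient the swaps, so that rewriting sorts the arguments of \<open>vol\<close>.\<close>

lemma vol_sort:
  "spatial_number j < spatial_number i \<Longrightarrow> vol i j k l = - vol j i k l"
  "spatial_number j < spatial_number i \<Longrightarrow> vol k i j l = - vol k j i l"
  "spatial_number j < spatial_number i \<Longrightarrow> vol k l i j = - vol k l j i"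
  by (rule vol_swap)+

text \<open>Five transpositions, an odd number, take the orienting order x, y, v, u to the sorted
  order v, u, y, x. This sign decides which half of the two-forms counts as anti-self-dual.\<close>

lemma vol_1: "vol (0, 0) (0, 1) (1, 0) (1, 1) = - 1"
proof -
  have "vol (1, 1) (1, 0) (0, 0) (0, 1) = det (mat 1 :: complex ^ spatial ^ spatial)"
    unfolding vol_def
    by (rule arg_cong[of _ _ det]) (simp add: vec_eq_iff all_two mat_def axis_def)
  then have "- vol (0, 0) (0, 1) (1, 0) (1, 1) = 1"
    by (simp add: vol_sort spatial_number_def)
  then show ?thesis by (simp add: minus_equation_iff)
qed

text \<open>Each row of \<open>flat\<close> has one non-zero entry, at the index with both spinor
  indices flipped, so the double sum collapses to one term. In the type \<open>2\<close>,
  \<open>1 - A\<close> is that flip.\<close>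

lemma raise_two_form:
  "(\<Sum>m\<in>UNIV. \<Sum>n\<in>UNIV. flat k m * flat l n * W $ m $ n) =
     (let d = (\<lambda>i. (1 - fst i, 1 - snd i)) in flat k (d k) * flat l (d l) * W $ d k $ d l)"
proof -
  have *: "(\<Sum>m\<in>UNIV. flat k m * g m) = flat k (1 - fst k, 1 - snd k) * g (1 - fst k, 1 - snd k)" for g k
  proof -
    have "\<forall>k. (\<Sum>m\<in>UNIV. flat k m * g m) = flat k (1 - fst k, 1 - snd k) * g (1 - fst k, 1 - snd k)"
      by (simp add: all_two sum_spatial flat_def)
    then show ?thesis by blast
  qed
  have "(\<Sum>m\<in>UNIV. \<Sum>n\<in>UNIV. flat k m * flat l n * W $ m $ n) =
      (\<Sum>m\<in>UNIV. flat k m * (\<Sum>n\<in>UNIV. flat l n * W $ m $ n))"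
    by (simp add: sum_distrib_left mult.assoc)
  also have "\<dots> = flat k (1 - fst k, 1 - snd k) *
      (flat l (1 - fst l, 1 - snd l) * W $ (1 - fst k, 1 - snd k) $ (1 - fst l, 1 - snd l))"
    unfolding * ..
  finally show ?thesis by (simp add: Let_def mult.assoc)
qed

lemma hodge_nth:
  "hodge W $ i $ j = (\<Sum>k\<in>UNIV. \<Sum>l\<in>UNIV. vol i j k l *
     (let d = (\<lambda>i. (1 - fst i, 1 - snd i)) in flat k (d k) * flat l (d l) * W $ d k $ d l)) / 2"
  unfolding hodge_def raise_two_form[symmetric] by (simp add: sum_distrib_left mult.assoc)

lemma hodge_values:
  "hodge W $ (0, 0) $ (0, 0) = 0" "hodge W $ (0, 1) $ (0, 1) = 0"
  "hodge W $ (1, 0) $ (1, 0) = 0" "hodge W $ (1, 1) $ (1, 1) = 0"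
  "hodge W $ (0, 0) $ (0, 1) = (W $ (0, 1) $ (0, 0) - W $ (0, 0) $ (0, 1)) / 2"
  "hodge W $ (0, 1) $ (0, 0) = (W $ (0, 0) $ (0, 1) - W $ (0, 1) $ (0, 0)) / 2"
  "hodge W $ (1, 0) $ (1, 1) = (W $ (1, 1) $ (1, 0) - W $ (1, 0) $ (1, 1)) / 2"
  "hodge W $ (1, 1) $ (1, 0) = (W $ (1, 0) $ (1, 1) - W $ (1, 1) $ (1, 0)) / 2"
  "hodge W $ (0, 0) $ (1, 0) = (W $ (0, 0) $ (1, 0) - W $ (1, 0) $ (0, 0)) / 2"
  "hodge W $ (1, 0) $ (0, 0) = (W $ (1, 0) $ (0, 0) - W $ (0, 0) $ (1, 0)) / 2"
  "hodge W $ (0, 1) $ (1, 1) = (W $ (0, 1) $ (1, 1) - W $ (1, 1) $ (0, 1)) / 2"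
  "hodge W $ (1, 1) $ (0, 1) = (W $ (1, 1) $ (0, 1) - W $ (0, 1) $ (1, 1)) / 2"
  "hodge W $ (0, 0) $ (1, 1) = (W $ (0, 1) $ (1, 0) - W $ (1, 0) $ (0, 1)) / 2"
  "hodge W $ (1, 1) $ (0, 0) = (W $ (1, 0) $ (0, 1) - W $ (0, 1) $ (1, 0)) / 2"
  "hodge W $ (0, 1) $ (1, 0) = (W $ (0, 0) $ (1, 1) - W $ (1, 1) $ (0, 0)) / 2"
  "hodge W $ (1, 0) $ (0, 1) = (W $ (1, 1) $ (0, 0) - W $ (0, 0) $ (1, 1)) / 2"
  by (simp_all add: hodge_nth Let_def flat_def sum_spatial vol_eq_0 vol_sort vol_1 spatial_number_def)

text \<open>A two-form splits as \<phi>_{AB} eps_{A'B'} + eps_{AB} \<psi>_{A'B'} with \<phi>, \<psi>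
  symmetric. The two summands are the eigenspaces of the Hodge star, and in the chosen orientation
  the first has eigenvalue -1.\<close>

lemma anti_self_dual_iff:
  "anti_self_dual W \<longleftrightarrow>
     (\<exists>\<phi>. \<phi> 0 1 = \<phi> 1 0 \<and> (\<forall>i j. W $ i $ j = \<phi> (fst i) (fst j) * eps (snd i) (snd j)))"
proof
  assume "anti_self_dual W"
  then have *: "transpose W = - W" "hodge W = - W"
    by (simp_all only: anti_self_dual_def)
  have skew: "W $ j $ i = - W $ i $ j" and asd: "hodge W $ i $ j = - W $ i $ j" for i j
    using arg_cong[OF *(1), of "\<lambda>M. M $ i $ j"] arg_cong[OF *(2), of "\<lambda>M. M $ i $ j"]
    by (simp_all add: transpose_def)
  have "W $ i $ i = 0" for i
    using skew[of i i] by simp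
  \<comment> \<open>These three equations kill \<psi>_{00}, \<psi>_{11} and \<psi>_{01}, the
    self-dual part.\<close>
  moreover have "W $ (0, 0) $ (1, 0) = 0" "W $ (0, 1) $ (1, 1) = 0"
      "W $ (0, 1) $ (1, 0) = - W $ (0, 0) $ (1, 1)"
    using asd[of "(0, 0)" "(1, 0)"] asd[of "(0, 1)" "(1, 1)"] asd[of "(0, 0)" "(1, 1)"]
      skew[of "(1, 0)" "(0, 0)"] skew[of "(1, 1)" "(0, 1)"] skew[of "(1, 0)" "(0, 1)"]
    by (simp_all add: hodge_values)
  \<comment> \<open>As \<open>eps 0 1 = 1\<close>, the primed indices 0, 1 isolate \<phi>.\<close>
  ultimately show "\<exists>\<phi>. \<phi> 0 1 = \<phi> 1 0 \<and> (\<forall>i j. W $ i $ j = \<phi> (fst i) (fst j) * eps (snd i) (snd j))"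
    using skew[of "(0, 1)" "(0, 0)"] skew[of "(1, 1)" "(1, 0)"] skew[of "(1, 0)" "(0, 0)"]
      skew[of "(1, 1)" "(0, 1)"] skew[of "(1, 0)" "(0, 1)"] skew[of "(1, 1)" "(0, 0)"]
    by (intro exI[of _ "\<lambda>A B. W $ (A, 0) $ (B, 1)"]) (simp add: all_two)
next
  assume "\<exists>\<phi>. \<phi> 0 1 = \<phi> 1 0 \<and> (\<forall>i j. W $ i $ j = \<phi> (fst i) (fst j) * eps (snd i) (snd j))"
  then show "anti_self_dual W"
    by (auto simp: anti_self_dual_def transpose_def vec_eq_iff all_two hodge_values)
qed

text \<open>The symmetric \<phi> has the free entries \<phi>_{00}, \<phi>_{11} and \<phi>_{01},
  which makes precise that the Coriolis form amounts to three arbitrary functions.\<close>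

lemma anti_self_dual_components:
  "\<exists>!W. anti_self_dual W \<and>
     W $ (0, 0) $ (0, 1) = a \<and> W $ (1, 0) $ (1, 1) = b \<and> W $ (0, 0) $ (1, 1) = c"
proof (rule ex1I)
  define \<phi> where "\<phi> A B = (if A \<noteq> B then c else if A = 0 then a else b)" for A B :: 2
  show "anti_self_dual (\<chi> i j. \<phi> (fst i) (fst j) * eps (snd i) (snd j)) \<and>
    (\<chi> i j. \<phi> (fst i) (fst j) * eps (snd i) (snd j)) $ (0, 0) $ (0, 1) = a \<and>
    (\<chi> i j. \<phi> (fst i) (fst j) * eps (snd i) (snd j)) $ (1, 0) $ (1, 1) = b \<and>
    (\<chi> i j. \<phi> (fst i) (fst j) * eps (snd i) (snd j)) $ (0, 0) $ (1, 1) = c"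
    unfolding anti_self_dual_iff by (auto simp: \<phi>_def intro!: exI[of _ \<phi>])
  fix W assume W: "anti_self_dual W \<and>
     W $ (0, 0) $ (0, 1) = a \<and> W $ (1, 0) $ (1, 1) = b \<and> W $ (0, 0) $ (1, 1) = c"
  then obtain \<psi> where "\<psi> 0 1 = \<psi> 1 0" "\<forall>i j. W $ i $ j = \<psi> (fst i) (fst j) * eps (snd i) (snd j)"
    unfolding anti_self_dual_iff by blast
  then show "W = (\<chi> i j. \<phi> (fst i) (fst j) * eps (snd i) (snd j))"
    using W by (simp add: vec_eq_iff all_two \<phi>_def)
qed

section \<open>The normal bundle and its splittings\<close>

text \<open>The transition factor of the summand O(d) to which the fibre coordinate belongs, the
  power -d of \<open>l\<close>.\<close>

definition weight :: "complex \<Rightarrow> fibre \<Rightarrow> complex" where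
  "weight l \<mu> = (case \<mu> of None \<Rightarrow> 1 | Some A \<Rightarrow> inverse l)"

lemma weight_simps [simp]: "weight l None = 1" "weight l (Some A) = inverse l"
  by (simp_all add: weight_def)

lemma pd_patch: "pd \<nu> (\<lambda>w. patch l w $ \<mu>) = (\<lambda>w. if \<mu> = \<nu> then weight l \<mu> else 0)"
proof
  fix w
  have "(\<lambda>w. patch l w $ \<mu>) = (\<lambda>w. weight l \<mu> * w $ \<mu>)"
    by (cases \<mu>) (auto simp: patch_def)
  moreover have "pd \<nu> (\<lambda>w. weight l \<mu> * w $ \<mu>) w = (if \<mu> = \<nu> then weight l \<mu> else 0)"
    by (rule pd_eqI) (auto simp: axis_def intro!: derivative_eq_intros)
  ultimately show "pd \<nu> (\<lambda>w. patch l w $ \<mu>) w = (if \<mu> = \<nu> then weight l \<mu> else 0)"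
    by simp
qed

lemma patch1_nth: "patch1 x l $ \<mu> $ \<nu> = (if \<mu> = \<nu> then weight l \<mu> else 0)"
  by (simp add: patch1_def pd_patch)

lemma patch1_eq: "patch1 x l = model_patch l"
  by (simp add: vec_eq_iff patch1_nth model_patch_def weight_def)

lemma model_patch_nth: "model_patch l $ \<mu> $ \<nu> = (if \<mu> = \<nu> then weight l \<mu> else 0)"
  by (simp add: model_patch_def weight_def)

lemma patch2_eq: "patch2 x l \<mu> \<nu> \<rho> = 0"
  by (simp add: patch2_def pd_patch)

lemma pd_line:
  "pd a (\<lambda>y. line y l $ \<mu>) = (\<lambda>y. case \<mu> of None \<Rightarrow> of_bool (a = None)
     | Some A \<Rightarrow> of_bool (a = Some (A, 1)) + of_bool (a = Some (A, 0)) * l)"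
proof
  fix x show "pd a (\<lambda>y. line y l $ \<mu>) x = (case \<mu> of None \<Rightarrow> of_bool (a = None)
     | Some A \<Rightarrow> of_bool (a = Some (A, 1)) + of_bool (a = Some (A, 0)) * l)"
    by (rule pd_eqI, cases \<mu>) (auto simp: axis_def intro!: derivative_eq_intros)
qed

lemma line_diff_nth:
  "line_diff x l $ None $ a = of_bool (a = None)"
  "line_diff x l $ Some A $ None = 0"
  "line_diff x l $ Some A $ Some (B, B') = of_bool (A = B) * (if B' = 1 then 1 else l)"
  using two_cases[of B'] by (auto simp: line_diff_def pd_line)

lemma pd_pd_line: "pd b (pd c (\<lambda>y. line y l $ \<mu>)) x = 0"
  by (simp add: pd_line)

lemma matrix_inv_mult:
  fixes A :: "'a::field ^ 'n ^ 'n"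
  assumes "invertible A"
  shows "matrix_inv A ** A = mat 1" "A ** matrix_inv A = mat 1"
  using someI_ex[OF assms[unfolded invertible_def]] by (simp_all add: matrix_inv_def)

lemma matrix_inv_eqI:
  fixes A :: "'a::field ^ 'n ^ 'n"
  assumes "A ** B = mat 1"
  shows "matrix_inv A = B"
proof -
  have "invertible A" using assms invertible_right_inverse by blast
  then have "matrix_inv A = matrix_inv A ** (A ** B)" by (simp add: assms)
  also have "\<dots> = B" using \<open>invertible A\<close> by (simp add: matrix_mul_assoc matrix_inv_mult)
  finally show ?thesis .
qed

text \<open>Multiplying the factorisation by \<open>H\<close> on the right turns it into scalar
  transition laws, one for each entry of \<open>H\<close>.\<close>

lemma splitting_transition:
  assumes "splitting I H H'" "x \<in> over I" "l \<noteq> 0"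
  shows "weight l \<mu> * H x l $ \<mu> $ \<nu> = H' x (inverse l) $ \<mu> $ \<nu> * weight l \<nu>"
proof -
  have inv: "invertible (H x l)"
    and eq: "model_patch l = H' x (inverse l) ** model_patch l ** matrix_inv (H x l)"
    using assms unfolding splitting_def patch1_eq by blast+
  have "model_patch l ** H x l = H' x (inverse l) ** model_patch l ** (matrix_inv (H x l) ** H x l)"
    using eq by (simp add: matrix_mul_assoc)
  then have "(model_patch l ** H x l) $ \<mu> $ \<nu> = (H' x (inverse l) ** model_patch l) $ \<mu> $ \<nu>"
    using inv by (simp add: matrix_inv_mult)
  then show ?thesis
    by (simp add: matrix_matrix_mult_def model_patch_nth if_distrib if_distribR cong: if_cong)
qed

text \<open>The degrees are 0, -1 and 0. The remaining entries, from \<open>None\<close> to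
  \<open>Some A\<close>, have degree 1 and may be affine in \<open>l\<close>.\<close>

lemma splitting_structure:
  assumes "splitting I H H'" "x \<in> over I"
  shows "H x l $ None $ None = H x 0 $ None $ None"
    and "H x l $ None $ Some B = 0"
    and "H x l $ Some A $ Some B = H x 0 $ Some A $ Some B"
proof -
  have hol: "(\<lambda>l. H x l $ \<mu> $ \<nu>) holomorphic_on UNIV" "(\<lambda>l. H' x l $ \<mu> $ \<nu>) holomorphic_on UNIV" for \<mu> \<nu>
    using assms unfolding splitting_def by blast+
  note tr = splitting_transition[OF assms]
  show "H x l $ None $ None = H x 0 $ None $ None"
    by (rule entire_const_if_patched[OF hol]) (use tr[of _ None None] in auto)
  show "H x l $ None $ Some B = 0"
    by (rule entire_zero_if_patched[OF hol(1) hol(2)[of None "Some B"]])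
       (use tr[of _ None "Some B"] in \<open>auto simp: field_simps\<close>)
  show "H x l $ Some A $ Some B = H x 0 $ Some A $ Some B"
    by (rule entire_const_if_patched[OF hol(1) hol(2)[of "Some A" "Some B"]])
       (use tr[of _ "Some A" "Some B"] in \<open>auto simp: field_simps\<close>)
qed

text \<open>Modulo dt, comparison of powers of \<open>l\<close> gives e^{EE'} = K^E_C dx^{CE'} with
  K inverse to the block \<open>B\<close>. The spatial part of the degenerate metric is thus det K
  times \<open>flat\<close>. Inverting it gives det \<open>B\<close>, while \<open>h\<close>
  annihilating \<theta> removes every component along t.\<close>

lemma frame_geometry:
  fixes H :: "pt \<Rightarrow> complex \<Rightarrow> complex ^ fibre ^ fibre"
  assumes "splitting I H H'" "frame_components I H \<theta> e" "x \<in> over I"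
    "projective_inverse (\<theta> x) (degenerate_metric (e x)) (h x)"
  defines "\<alpha> \<equiv> H x 0 $ None $ None" and "B \<equiv> (\<lambda>A C. H x 0 $ Some A $ Some C)"
  defines "\<Delta> \<equiv> B 0 0 * B 1 1 - B 0 1 * B 1 0"
  shows "\<alpha> \<noteq> 0" "\<Delta> \<noteq> 0" "\<theta> x $ a = (if a = None then 1 / \<alpha> else 0)"
    "h x $ None $ b = 0" "h x $ a $ None = 0" "h x $ Some i $ Some j = \<Delta> * flat i j"
proof -
  have str: "H x l $ None $ None = \<alpha>" "H x l $ None $ Some C = 0" "H x l $ Some A $ Some C = B A C" for l A C
    unfolding \<alpha>_def B_def using splitting_structure[OF assms(1,3)] by blast+
  have inv: "invertible (H x l)" for l
    using assms(1,3) unfolding splitting_def by blast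
  \<comment> \<open>Multiplying by \<open>H\<close>, rather than computing its inverse, keeps the
    equations linear in the unknown forms.\<close>
  have "H x l ** frame_section H x l = line_diff x l" for l
    by (simp add: frame_section_def matrix_mul_assoc matrix_inv_mult inv)
  then have "(H x l ** frame_section H x l) $ \<mu> $ a = line_diff x l $ \<mu> $ a" for l \<mu> a
    by simp
  moreover have "frame_section H x l $ None = \<theta> x"
    "frame_section H x l $ Some A = e x (A, 1) + l *s e x (A, 0)" for l A
    using assms(2,3) unfolding frame_components_def by blast+
  ultimately have eq: "H x l $ \<mu> $ None * \<theta> x $ a
      + (\<Sum>A\<in>UNIV. H x l $ \<mu> $ Some A * (e x (A, 1) $ a + l * e x (A, 0) $ a)) = line_diff x l $ \<mu> $ a"
    for l \<mu> a
    by (simp add: matrix_matrix_mult_def sum_option)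
  have *: "\<alpha> * \<theta> x $ a = of_bool (a = None)" for a
    using eq[of 0 None a] by (simp add: str line_diff_nth)
  from *[of None] show \<alpha>: "\<alpha> \<noteq> 0" by auto
  show \<theta>: "\<theta> x $ a = (if a = None then 1 / \<alpha> else 0)" for a
    using *[of a] \<alpha> by (cases a) (auto simp: field_simps)
  have rows: "(\<Sum>E\<in>UNIV. B A E * (e x (E, 1) $ Some (C, C') + l * e x (E, 0) $ Some (C, C'))) =
      of_bool (A = C) * (if C' = 1 then 1 else l)" for A C C' l
    using eq[of l "Some A" "Some (C, C')"] by (simp add: str line_diff_nth \<theta>)
  define K where "K E C = e x (E, 1) $ Some (C, 1)" for E C
  have row1: "B A 0 * e x (0, 1) $ Some (C, C') + B A 1 * e x (1, 1) $ Some (C, C') =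
      of_bool (A = C \<and> C' = 1)" for A C C'
    using rows[of A C C' 0] by (simp add: sum_two split: if_splits)
  \<comment> \<open>The equation at \<open>l = 1\<close> minus the one at \<open>l = 0\<close>
    isolates the coefficient of \<open>l\<close>.\<close>
  have row0: "B A 0 * e x (0, 0) $ Some (C, C') + B A 1 * e x (1, 0) $ Some (C, C') =
      of_bool (A = C \<and> C' = 0)" for A C C'
  proof -
    have "(B A 0 * e x (0, 0) $ Some (C, C') + B A 1 * e x (1, 0) $ Some (C, C')) +
        (B A 0 * e x (0, 1) $ Some (C, C') + B A 1 * e x (1, 1) $ Some (C, C')) = of_bool (A = C)"
      using rows[of A C C' 1] by (simp add: sum_two algebra_simps)
    then have "B A 0 * e x (0, 0) $ Some (C, C') + B A 1 * e x (1, 0) $ Some (C, C') =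
        of_bool (A = C) - of_bool (A = C \<and> C' = 1)"
      unfolding row1 by (simp add: eq_diff_eq)
    then show ?thesis using two_cases[of C'] by auto
  qed
  define k where "k = K 0 0 * K 1 1 - K 0 1 * K 1 0"
  have BK: "B A 0 * K 0 C + B A 1 * K 1 C = of_bool (A = C)" for A C
    using row1[of A C 1] by (simp add: K_def)
  have \<Delta>k: "\<Delta> * k = 1"
    using BK[of 0 0] BK[of 0 1] BK[of 1 0] BK[of 1 1] unfolding \<Delta>_def k_def of_bool_def
    by simp algebra
  then show \<Delta>: "\<Delta> \<noteq> 0" by auto
  have cramer: "z0 = 0 \<and> z1 = 0" if "B 0 0 * z0 + B 0 1 * z1 = 0" "B 1 0 * z0 + B 1 1 * z1 = 0" for z0 z1
  proof -
    have "\<Delta> * z0 = 0" "\<Delta> * z1 = 0" using that unfolding \<Delta>_def by algebra+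
    then show ?thesis using \<Delta> by simp
  qed
  have e: "e x (E, E') $ Some (C, C') = (if E' = C' then K E C else 0)" for E E' C C'
  proof -
    have "e x (0, E') $ Some (C, C') - (if E' = C' then K 0 C else 0) = 0 \<and>
          e x (1, E') $ Some (C, C') - (if E' = C' then K 1 C else 0) = 0"
      by (rule cramer)
        (use two_cases[of E'] two_cases[of C'] row0[of _ C C'] row1[of _ C C'] BK[of _ C] in
          \<open>auto simp: algebra_simps\<close>)
    then show ?thesis using two_cases[of E] by auto
  qed
  \<comment> \<open>Under a 2x2 matrix \<open>eps\<close> is multiplied by the determinant, here
    \<open>k\<close>, the determinant of \<open>K\<close>.\<close>
  have g: "degenerate_metric (e x) $ Some i $ Some j = k * flat i j" for i j
  proof -
    have "\<forall>i j. degenerate_metric (e x) $ Some i $ Some j = k * flat i j"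
      by (simp add: degenerate_metric_def all_two sum_spatial flat_def e k_def algebra_simps)
    then show ?thesis by blast
  qed
  obtain U where U: "h x ** degenerate_metric (e x) = mat 1 - (\<chi> a c. U $ a * \<theta> x $ c)"
    and h\<theta>: "h x *v \<theta> x = 0"
    using assms(4) unfolding projective_inverse_def by blast
  have "(h x *v \<theta> x) $ a = 0" for a using h\<theta> by simp
  then show hN: "h x $ a $ None = 0" for a
    using \<alpha> by (simp add: matrix_vector_mult_def sum_option \<theta>)
  have "(h x ** degenerate_metric (e x)) $ a $ Some c = of_bool (a = Some c)" for a c
    unfolding U by (simp add: \<theta> mat_def)
  then have hg: "(\<Sum>l\<in>UNIV. h x $ a $ Some l * (k * flat l c)) = of_bool (a = Some c)" for a c
    by (simp add: matrix_matrix_mult_def sum_option hN g)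
  \<comment> \<open>Contract \<open>hg\<close> with \<open>flat\<close>, its own inverse, and
    replace division by \<open>k\<close> with multiplication by \<Delta>.\<close>
  have h: "h x $ a $ Some j = \<Delta> * (\<Sum>c\<in>UNIV. of_bool (a = Some c) * flat c j)" for a j
  proof -
    have "(\<Sum>c\<in>UNIV. of_bool (a = Some c) * flat c j) =
        (\<Sum>c\<in>UNIV. \<Sum>l\<in>UNIV. h x $ a $ Some l * (k * flat l c) * flat c j)"
      unfolding hg[symmetric] by (simp add: sum_distrib_right)
    also have "\<dots> = (\<Sum>l\<in>UNIV. h x $ a $ Some l * k * (\<Sum>c\<in>UNIV. flat l c * flat c j))"
      by (subst sum.swap) (simp add: sum_distrib_left mult.assoc)
    also have "\<dots> = h x $ a $ Some j * k"
      by (simp add: flat_flat if_distrib cong: if_cong)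
    finally have "\<Delta> * (\<Sum>c\<in>UNIV. of_bool (a = Some c) * flat c j) = h x $ a $ Some j * (\<Delta> * k)"
      by simp
    then show ?thesis by (simp add: \<Delta>k)
  qed
  show "h x $ None $ b = 0"
    by (cases b) (simp_all add: hN h)
  show "h x $ Some i $ Some j = \<Delta> * flat i j"
    by (simp add: h)
qed

lemma induced_frame:
  assumes "induced I \<theta> h \<Gamma>"
  obtains \<mu> \<Delta> where "holo_on (over I) \<mu>" "holo_on (over I) \<Delta>"
    "\<And>x. x \<in> over I \<Longrightarrow> \<mu> x \<noteq> 0" "\<And>x. x \<in> over I \<Longrightarrow> \<Delta> x \<noteq> 0"
    "\<And>x a. x \<in> over I \<Longrightarrow> \<theta> x $ a = (if a = None then \<mu> x else 0)"
    "\<And>x b. x \<in> over I \<Longrightarrow> h x $ None $ b = 0" "\<And>x a. x \<in> over I \<Longrightarrow> h x $ a $ None = 0"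
    "\<And>x i j. x \<in> over I \<Longrightarrow> h x $ Some i $ Some j = \<Delta> x * flat i j"
proof -
  from assms obtain H H' e where *: "splitting I H H'" "frame_components I H \<theta> e"
    "\<And>x. x \<in> over I \<Longrightarrow> projective_inverse (\<theta> x) (degenerate_metric (e x)) (h x)"
    unfolding induced_def by blast
  have holo: "holo_on (over I) (\<lambda>x. H x 0 $ \<mu> $ \<nu>)" for \<mu> \<nu>
    using *(1) unfolding splitting_def by blast
  note geo = frame_geometry[OF *(1,2)]
  have nz: "H x 0 $ None $ None \<noteq> 0" if "x \<in> over I" for x
    by (rule geo(1)[where h = h, OF that *(3)[OF that]])
  show ?thesis
  proof (rule that)
    show "holo_on (over I) (\<lambda>x. 1 / H x 0 $ None $ None)"
      by (rule holo_on_divide[OF holo_on_const holo nz])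
    show "holo_on (over I) (\<lambda>x. H x 0 $ Some 0 $ Some 0 * H x 0 $ Some 1 $ Some 1
        - H x 0 $ Some 0 $ Some 1 * H x 0 $ Some 1 $ Some 0)"
      by (intro holo_on_diff holo_on_mult holo)
    fix x assume x: "x \<in> over I"
    note g = geo[where h = h, OF x *(3)[OF x]]
    show "1 / H x 0 $ None $ None \<noteq> 0" using g(1) by simp
    show "H x 0 $ Some 0 $ Some 0 * H x 0 $ Some 1 $ Some 1
        - H x 0 $ Some 0 $ Some 1 * H x 0 $ Some 1 $ Some 0 \<noteq> 0" by (rule g(2))
    show "\<theta> x $ a = (if a = None then 1 / H x 0 $ None $ None else 0)" for a by (rule g(3))
    show "h x $ None $ b = 0" for b by (rule g(4))
    show "h x $ a $ None = 0" for a by (rule g(5))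
    show "h x $ Some i $ Some j = (H x 0 $ Some 0 $ Some 0 * H x 0 $ Some 1 $ Some 1
        - H x 0 $ Some 0 $ Some 1 * H x 0 $ Some 1 $ Some 0) * flat i j" for i j by (rule g(6))
  qed
qed

section \<open>The form of a \<open>\<Lambda>\<close>-connection\<close>

lemma sum_patch1: "(\<Sum>\<nu>\<in>UNIV. \<Sum>\<rho>\<in>UNIV. s \<nu> \<rho> * patch1 x l $ \<nu> $ \<alpha> * patch1 x l $ \<rho> $ \<beta>)
    = s \<alpha> \<beta> * weight l \<alpha> * weight l \<beta>"
proof -
  have "(\<Sum>\<nu>\<in>UNIV. \<Sum>\<rho>\<in>UNIV. s \<nu> \<rho> * patch1 x l $ \<nu> $ \<alpha> * patch1 x l $ \<rho> $ \<beta>)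
    = (\<Sum>\<nu>\<in>UNIV. \<Sum>\<rho>\<in>UNIV. if \<nu> = \<alpha> then if \<rho> = \<beta> then s \<nu> \<rho> * weight l \<nu> * weight l \<rho> else 0 else 0)"
    by (intro sum.cong refl) (simp add: patch1_nth)
  also have "\<dots> = s \<alpha> \<beta> * weight l \<alpha> * weight l \<beta>"
    by (subst sum.swap) simp
  finally show ?thesis .
qed

lemma sum_patch1_left: "(\<Sum>\<eta>\<in>UNIV. patch1 x l $ \<mu> $ \<eta> * s \<eta>) = weight l \<mu> * s \<mu>"
  by (simp add: patch1_nth if_distrib if_distribR cong: if_cong)

text \<open>The patching is linear in the fibre and \<open>line\<close> is linear in the coordinates
  of M, so all second derivatives vanish. What remains says that \<sigma> is a global section of N
  tensored with the symmetric square of its dual, with scalar transition laws.\<close>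

lemma lambda_connection_iff:
  "lambda_connection I \<Gamma> \<longleftrightarrow> torsion_free (over I) \<Gamma> \<and>
     (\<exists>(\<sigma> :: pt \<Rightarrow> complex \<Rightarrow> fibre \<Rightarrow> fibre \<Rightarrow> fibre \<Rightarrow> complex)
       (\<sigma>' :: pt \<Rightarrow> complex \<Rightarrow> fibre \<Rightarrow> fibre \<Rightarrow> fibre \<Rightarrow> complex).
        (\<forall>\<mu> \<nu> \<rho>.
           (\<forall>x\<in>over I. (\<lambda>l. \<sigma> x l \<mu> \<nu> \<rho>) holomorphic_on UNIV \<and> (\<lambda>l. \<sigma>' x l \<mu> \<nu> \<rho>) holomorphic_on UNIV) \<and>
           (\<forall>l. holo_on (over I) (\<lambda>x. \<sigma> x l \<mu> \<nu> \<rho>) \<and> holo_on (over I) (\<lambda>x. \<sigma>' x l \<mu> \<nu> \<rho>)) \<and>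
           (\<forall>x\<in>over I. \<forall>l. \<sigma> x l \<mu> \<nu> \<rho> = \<sigma> x l \<mu> \<rho> \<nu> \<and> \<sigma>' x l \<mu> \<nu> \<rho> = \<sigma>' x l \<mu> \<rho> \<nu>)) \<and>
        (\<forall>x\<in>over I. \<forall>l \<mu> \<alpha> \<beta>. l \<noteq> 0 \<longrightarrow>
           weight l \<mu> * \<sigma> x l \<mu> \<alpha> \<beta> = \<sigma>' x (inverse l) \<mu> \<alpha> \<beta> * weight l \<alpha> * weight l \<beta>) \<and>
        (\<forall>x\<in>over I. \<forall>l \<mu> b c. (\<Sum>a\<in>UNIV. \<Gamma> x a b c * line_diff x l $ \<mu> $ a) =
           (\<Sum>\<nu>\<in>UNIV. \<Sum>\<rho>\<in>UNIV. \<sigma> x l \<mu> \<nu> \<rho> * line_diff x l $ \<nu> $ b * line_diff x l $ \<rho> $ c)))"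
proof -
  have "0 = - a + b \<longleftrightarrow> b = a" for a b :: complex
    by (auto simp: algebra_simps)
  then show ?thesis
    unfolding lambda_connection_def sum_patch1 sum_patch1_left patch2_eq pd_pd_line add_0_left by simp
qed

text \<open>Only the components T;TT, \<Omega>;T\<Omega> and \<Omega>;TT of \<sigma> have
  non-negative degree, namely 0, 0 and 1. In the mixed case a constant multiplies dx^{B1'} +
  \<lambda> dx^{B0'}, and equating the powers of \<lambda> on both sides produces the \<delta> in
  the primed indices. The component with both primed indices 1 then stands for that
  constant.\<close>

lemma lambda_connection_structure:
  assumes "lambda_connection I \<Gamma>"
  shows "x \<in> over I \<Longrightarrow> \<Gamma> x a b c = \<Gamma> x a c b"
    and "x \<in> over I \<Longrightarrow> \<Gamma> x None (Some i) c = 0"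
    and "x \<in> over I \<Longrightarrow> \<Gamma> x a (Some i) (Some j) = 0"
    and "x \<in> over I \<Longrightarrow> \<Gamma> x (Some (A, A')) None (Some (B, B')) =
           (if A' = B' then \<Gamma> x (Some (A, 1)) None (Some (B, 1)) else 0)"
    and "open I \<Longrightarrow> holo_on (over I) (\<lambda>x. \<Gamma> x a b c)"
proof -
  from assms obtain \<sigma> \<sigma>' :: "pt \<Rightarrow> complex \<Rightarrow> fibre \<Rightarrow> fibre \<Rightarrow> fibre \<Rightarrow> complex" where
    reg: "\<forall>\<mu> \<nu> \<rho>.
           (\<forall>x\<in>over I. (\<lambda>l. \<sigma> x l \<mu> \<nu> \<rho>) holomorphic_on UNIV \<and> (\<lambda>l. \<sigma>' x l \<mu> \<nu> \<rho>) holomorphic_on UNIV) \<and>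
           (\<forall>l. holo_on (over I) (\<lambda>x. \<sigma> x l \<mu> \<nu> \<rho>) \<and> holo_on (over I) (\<lambda>x. \<sigma>' x l \<mu> \<nu> \<rho>)) \<and>
           (\<forall>x\<in>over I. \<forall>l. \<sigma> x l \<mu> \<nu> \<rho> = \<sigma> x l \<mu> \<rho> \<nu> \<and> \<sigma>' x l \<mu> \<nu> \<rho> = \<sigma>' x l \<mu> \<rho> \<nu>)" and
    tr: "\<forall>x\<in>over I. \<forall>l \<mu> \<alpha> \<beta>. l \<noteq> 0 \<longrightarrow>
           weight l \<mu> * \<sigma> x l \<mu> \<alpha> \<beta> = \<sigma>' x (inverse l) \<mu> \<alpha> \<beta> * weight l \<alpha> * weight l \<beta>" and
    \<Gamma>: "\<forall>x\<in>over I. \<forall>l \<mu> b c. (\<Sum>a\<in>UNIV. \<Gamma> x a b c * line_diff x l $ \<mu> $ a) =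
       (\<Sum>\<nu>\<in>UNIV. \<Sum>\<rho>\<in>UNIV. \<sigma> x l \<mu> \<nu> \<rho> * line_diff x l $ \<nu> $ b * line_diff x l $ \<rho> $ c)"
    unfolding lambda_connection_iff by (elim conjE exE) (rule that; assumption)
  have hol: "(\<lambda>l. \<sigma> x l \<mu> \<nu> \<rho>) holomorphic_on UNIV" "(\<lambda>l. \<sigma>' x l \<mu> \<nu> \<rho>) holomorphic_on UNIV"
    if "x \<in> over I" for x \<mu> \<nu> \<rho>
    using reg that by blast+
  have holo: "holo_on (over I) (\<lambda>x. \<sigma> x l \<mu> \<nu> \<rho>)" for l \<mu> \<nu> \<rho>
    using reg by blast
  note tr = tr[rule_format] and \<Gamma> = \<Gamma>[rule_format]
  have "torsion_free (over I) \<Gamma>"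
    using assms unfolding lambda_connection_def by (rule conjunct1)
  then show sym: "\<Gamma> x a b c = \<Gamma> x a c b" if "x \<in> over I" for x a b c
    using that unfolding torsion_free_def by blast
  have L0: "\<Gamma> x None b c = (\<Sum>\<nu>\<in>UNIV. \<Sum>\<rho>\<in>UNIV. \<sigma> x l None \<nu> \<rho> * line_diff x l $ \<nu> $ b * line_diff x l $ \<rho> $ c)"
    if "x \<in> over I" for x b c l
    using \<Gamma>[OF that, of b c l None] by (simp add: sum_option line_diff_nth)
  have L1: "\<Gamma> x (Some (A, 1)) b c + \<Gamma> x (Some (A, 0)) b c * l =
      (\<Sum>\<nu>\<in>UNIV. \<Sum>\<rho>\<in>UNIV. \<sigma> x l (Some A) \<nu> \<rho> * line_diff x l $ \<nu> $ b * line_diff x l $ \<rho> $ c)"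
    if "x \<in> over I" for x b c l A
    using \<Gamma>[OF that, of b c l "Some A"] two_cases[of A]
    by (auto simp: sum_option sum_spatial line_diff_nth add.commute)
  have zero1: "\<sigma> x l None None (Some B) = 0" "\<sigma> x l None (Some B) None = 0"
    "\<sigma> x l (Some A) (Some B) (Some C) = 0" if x: "x \<in> over I" for x l A B C
  proof -
    show "\<sigma> x l None None (Some B) = 0"
      by (rule entire_zero_if_patched[OF hol[OF x]])
        (use tr[OF x, of _ None None "Some B"] in \<open>auto simp: field_simps\<close>)
    show "\<sigma> x l None (Some B) None = 0"
      by (rule entire_zero_if_patched[OF hol[OF x]])
        (use tr[OF x, of _ None "Some B" None] in \<open>auto simp: field_simps\<close>)
    show "\<sigma> x l (Some A) (Some B) (Some C) = 0"
      by (rule entire_zero_if_patched[OF hol[OF x]])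
        (use tr[OF x, of _ "Some A" "Some B" "Some C"] in \<open>auto simp: field_simps\<close>)
  qed
  \<comment> \<open>Degree -2: the result for O(-1) is applied first to \<open>m * \<sigma>\<close>,
    then to \<sigma> itself with zero as its partner.\<close>
  have zero2: "\<sigma> x l None (Some B) (Some C) = 0" if x: "x \<in> over I" for x l B C
  proof -
    have "m * \<sigma> x m None (Some B) (Some C) = 0" for m
      by (rule entire_zero_if_patched[OF _ hol(2)[OF x]])
        (use tr[OF x, of _ None "Some B" "Some C"] hol(1)[OF x] in
          \<open>auto simp: field_simps intro!: holomorphic_intros\<close>)
    then show ?thesis
      by (intro entire_zero_if_patched[OF hol(1)[OF x], of "\<lambda>_. 0"]) auto
  qed
  have const: "\<sigma> x l (Some A) None (Some C) = \<sigma> x 0 (Some A) None (Some C)"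
    if x: "x \<in> over I" for x l A C
    by (rule entire_const_if_patched[OF hol[OF x]])
      (use tr[OF x, of _ "Some A" None "Some C"] in \<open>auto simp: field_simps\<close>)
  show None: "\<Gamma> x None (Some i) c = 0" if "x \<in> over I" for x i c
    using L0[OF that, of "Some i" c 0]
    by (cases c) (simp_all add: sum_option line_diff_nth zero1 zero2 that)
  have Some: "\<Gamma> x (Some k) (Some i) (Some j) = 0" if "x \<in> over I" for x i j k
  proof -
    have *: "\<Gamma> x (Some (A, 1)) (Some i) (Some j) + \<Gamma> x (Some (A, 0)) (Some i) (Some j) * l = 0" for A l
      using L1[OF that, of A "Some i" "Some j" l] by (cases i; cases j)
         (simp add: sum_option line_diff_nth zero1 that)
    show ?thesis
      using *[of "fst k" 0] *[of "fst k" 1] two_cases[of "snd k"] by (cases k) auto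
  qed
  show "\<Gamma> x a (Some i) (Some j) = 0" if "x \<in> over I" for x a i j
    by (cases a) (simp_all add: None Some that)
  have mixed: "\<Gamma> x (Some (A, A')) None (Some (B, B')) = of_bool (A' = B') * \<sigma> x 0 (Some A) None (Some B)"
    if "x \<in> over I" for x A A' B B'
  proof -
    have *: "\<Gamma> x (Some (A, 1)) None (Some (B, B')) + \<Gamma> x (Some (A, 0)) None (Some (B, B')) * l
       = \<sigma> x 0 (Some A) None (Some B) * (if B' = 1 then 1 else l)" for l
    proof -
      have "(\<Sum>\<rho>\<in>UNIV. \<sigma> x l (Some A) None (Some \<rho>) * (of_bool (\<rho> = B) * (if B' = 1 then 1 else l)))
        = \<sigma> x l (Some A) None (Some B) * (if B' = 1 then 1 else l)"
        using two_cases[of B] by (auto simp: sum_two)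
      then show ?thesis
        using L1[OF that, of A None "Some (B, B')" l] const[OF that, of l A B]
        by (simp add: sum_option line_diff_nth mult.assoc)
    qed
    show ?thesis
      using *[of 0] *[of 1] two_cases[of A'] two_cases[of B'] by auto
  qed
  show "\<Gamma> x (Some (A, A')) None (Some (B, B')) =
      (if A' = B' then \<Gamma> x (Some (A, 1)) None (Some (B, 1)) else 0)" if "x \<in> over I" for x A A' B B'
    by (simp add: mixed that)
  \<comment> \<open>Each component of \<Gamma> is recovered from the contraction of \<sigma> at
    \<open>l = 0\<close> and \<open>l = 1\<close>, and so inherits holomorphy in \<open>x\<close>
    from \<sigma>.\<close>
  show "holo_on (over I) (\<lambda>x. \<Gamma> x a b c)" if "open I" for a b c
  proof -
    define L where "L = line_diff 0"
    have L: "line_diff x l = L l" for x l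
      by (simp add: L_def line_diff_def pd_line)
    have R: "holo_on (over I) (\<lambda>x. \<Sum>\<nu>\<in>UNIV. \<Sum>\<rho>\<in>UNIV. \<sigma> x l \<mu> \<nu> \<rho> * L l $ \<nu> $ b * L l $ \<rho> $ c)" for l \<mu>
      by (intro holo_on_sum holo_on_mult holo holo_on_const)
    note tf = holo_on_transform[OF _ open_over[OF that]]
    have R1: "holo_on (over I) (\<lambda>x. \<Gamma> x (Some (A, 1)) b c + \<Gamma> x (Some (A, 0)) b c * l)" for A l
      by (rule tf[OF R[of l "Some A"]]) (simp add: L1 L)
    have R2: "holo_on (over I) (\<lambda>x. \<Gamma> x (Some (A, 1)) b c)" for A
      by (rule tf[OF R1[of A 0]]) simp
    have R3: "holo_on (over I) (\<lambda>x. \<Gamma> x (Some (A, 0)) b c)" for A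
      by (rule tf[OF holo_on_diff[OF R1[of A 1] R2[of A]]]) simp
    have R0: "holo_on (over I) (\<lambda>x. \<Gamma> x None b c)"
      by (rule tf[OF R[of 0 None]]) (simp add: L0[of _ b c 0] L)
    show ?thesis
    proof (cases a)
      case (Some i)
      then show ?thesis using R2 R3 two_cases[of "snd i"] by (cases i) auto
    qed (simp add: R0)
  qed
qed

section \<open>The induced Newton-Cartan spacetimes\<close>

text \<open>With \<open>1 / f\<close> in place of \<open>f\<close> the same matrix also serves as a
  degenerate covariant metric.\<close>

definition nc_metric :: "(complex \<Rightarrow> complex) \<Rightarrow> pt \<Rightarrow> complex ^ coord ^ coord" where
  "nc_metric f x = (\<chi> a b. case (a, b) of (Some i, Some j) \<Rightarrow> f (x $ None) * flat i j | _ \<Rightarrow> 0)"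

lemma nc_metric_nth [simp]:
  "nc_metric f x $ None $ b = 0" "nc_metric f x $ a $ None = 0"
  "nc_metric f x $ Some i $ Some j = f (x $ None) * flat i j"
  by (simp_all add: nc_metric_def split: option.split)

lemma nc_metric_transpose: "transpose (nc_metric f x) = nc_metric f x"
  by (simp add: vec_eq_iff transpose_def all_option flat_sym)

text \<open>Used for \<open>h\<close>, where it gives the span of the clock, and for the covariant
  metric, where it gives uniqueness of the vector field dual to the clock.\<close>

lemma nc_metric_kernel:
  assumes "f (x $ None) \<noteq> 0"
  shows "{\<alpha>. nc_metric f x *v \<alpha> = 0} = vec.span {axis None 1}"
proof (intro set_eqI iffI)
  fix \<alpha> assume "\<alpha> \<in> {\<alpha>. nc_metric f x *v \<alpha> = 0}"
  then have "nc_metric f x *v \<alpha> = 0" by simp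
  then have *: "(nc_metric f x *v \<alpha>) $ Some i = 0" for i
    by simp
  have "\<forall>i. \<alpha> $ Some i = 0"
    using *[of "(0, 0)"] *[of "(0, 1)"] *[of "(1, 0)"] *[of "(1, 1)"] assms
    by (simp add: matrix_vector_mult_def sum_option sum_spatial flat_def all_two)
  then have "\<alpha> = \<alpha> $ None *s axis None 1"
    by (simp add: vec_eq_iff all_option axis_def)
  then show "\<alpha> \<in> vec.span {axis None 1}"
    by (metis vec.span_scale vec.span_base singletonI)
next
  fix \<alpha> :: "complex ^ coord" assume "\<alpha> \<in> vec.span {axis None 1}"
  then obtain k where "\<alpha> = k *s axis None 1"
    by (auto simp: vec.span_singleton)
  then show "\<alpha> \<in> {\<alpha>. nc_metric f x *v \<alpha> = 0}"
    by (simp add: vec_eq_iff matrix_vector_mult_def sum_option axis_def)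
qed

text \<open>The row of t is zero, and the spatial rows are non-zero multiples of four distinct basis
  vectors.\<close>

lemma nc_metric_rank:
  assumes "f (x $ None) \<noteq> 0"
  shows "rank (nc_metric f x) = 4"
proof -
  let ?R = "rows (nc_metric f x)" and ?B = "range (\<lambda>i::spatial. axis (Some i) 1 :: complex ^ coord)"
  have row_Some: "row (Some i) (nc_metric f x) = (f (x $ None) * flat i (1 - fst i, 1 - snd i)) *s
      axis (Some (1 - fst i, 1 - snd i)) 1" for i
  proof -
    have "\<forall>i. row (Some i) (nc_metric f x) = (f (x $ None) * flat i (1 - fst i, 1 - snd i)) *s
      axis (Some (1 - fst i, 1 - snd i)) 1"
      by (simp add: row_def vec_eq_iff all_option all_two flat_def axis_def)
    then show ?thesis by blast
  qed
  have row_None: "row None (nc_metric f x) = 0"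
    by (simp add: row_def vec_eq_iff)
  have "vec.span ?R = vec.span ?B"
  proof (rule vec.span_eq[THEN iffD2], intro conjI)
    have "row a (nc_metric f x) \<in> vec.span ?B" for a
    proof (cases a)
      case (Some i)
      show ?thesis unfolding Some row_Some by (intro vec.span_scale vec.span_base) simp
    qed (simp add: row_None vec.span_zero)
    then show "?R \<subseteq> vec.span ?B" by (auto simp: rows_def)
    have "axis (Some i) 1 \<in> vec.span ?R" for i
    proof -
      define d :: spatial where "d = (1 - fst i, 1 - snd i)"
      define c where "c = f (x $ None) * flat d i"
      have d: "(1 - fst d, 1 - snd d) = i" by (simp add: d_def)
      have "flat d i \<noteq> 0"
        using two_cases[of "fst i"] two_cases[of "snd i"] unfolding d_def
        by (auto simp: flat_def)
      then have "c \<noteq> 0" using assms by (simp add: c_def)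
      have "c *s axis (Some i) 1 \<in> vec.span ?R"
        using row_Some[of d] unfolding d c_def[symmetric]
        by (metis (mono_tags, lifting) rows_def mem_Collect_eq UNIV_I vec.span_base)
      then have "inverse c *s (c *s axis (Some i) 1) \<in> vec.span ?R"
        by (rule vec.span_scale)
      then show ?thesis using \<open>c \<noteq> 0\<close> by (simp add: vector_smult_assoc)
    qed
    then show "?B \<subseteq> vec.span ?R" by auto
  qed
  then have "rank (nc_metric f x) = vec.dim ?B"
    unfolding row_rank_def_gen by (metis vec.dim_span)
  also have "\<dots> = card ?B"
  proof (rule vec.dim_eq_card_independent)
    show "vec.independent ?B"
      by (rule vec.independent_mono[OF independent_cart_basis]) (auto simp: cart_basis_def)
  qed
  also have "\<dots> = CARD(spatial)"
    by (intro card_image) (auto simp: inj_on_def axis_eq_axis)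
  finally show ?thesis by simp
qed

lemma spatial_metric_nc_metric:
  assumes "f (x $ None) \<noteq> 0"
  shows "spatial_metric (nc_metric f x) = (\<chi> i j. flat i j / f (x $ None))"
proof -
  have "(\<chi> i j. nc_metric f x $ Some i $ Some j) ** (\<chi> i j. flat i j / f (x $ None)) = mat 1"
    using assms by (simp add: vec_eq_iff matrix_matrix_mult_def mat_def flat_flat)
  then show ?thesis unfolding spatial_metric_def by (rule matrix_inv_eqI)
qed

lemma coriolis_cong: "h x = h' x \<Longrightarrow> coriolis h \<Gamma> x = coriolis h' \<Gamma> x"
  by (simp add: coriolis_def)

text \<open>Raising undoes the lowering because \<open>flat\<close> squares to the identity. The
  trace premise restores the rest: a quarter of -2 f'/f is the diagonal term of
  \<open>nc_mixed\<close>.\<close>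

lemma nc_mixed_coriolis:
  assumes "f (x $ None) \<noteq> 0"
    "(\<Sum>l\<in>UNIV. \<Gamma> x (Some l) (Some l) None) = - 2 * deriv f (x $ None) / f (x $ None)"
  shows "nc_mixed f (coriolis (nc_metric f) \<Gamma>) x i j = \<Gamma> x (Some i) (Some j) None"
proof -
  define X where "X k = \<Gamma> x (Some k) (Some j) None
    - (if k = j then (\<Sum>l\<in>UNIV. \<Gamma> x (Some l) (Some l) None) / 4 else 0)" for k
  have "coriolis (nc_metric f) \<Gamma> x $ k $ j = (\<Sum>l\<in>UNIV. flat k l / f (x $ None) * X l)" for k
    using assms(1) by (simp add: coriolis_def spatial_metric_nc_metric X_def)
  then have "(\<Sum>k\<in>UNIV. f (x $ None) * flat i k * coriolis (nc_metric f) \<Gamma> x $ k $ j) =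
      (\<Sum>k\<in>UNIV. \<Sum>l\<in>UNIV. flat i k * flat k l * X l)"
    using assms(1) by (simp add: sum_distrib_left field_simps)
  also have "\<dots> = (\<Sum>l\<in>UNIV. (\<Sum>k\<in>UNIV. flat i k * flat k l) * X l)"
    by (subst sum.swap) (simp add: sum_distrib_right)
  also have "\<dots> = X i"
    by (simp add: flat_flat if_distrib if_distribR cong: if_cong)
  finally show ?thesis
    by (simp add: nc_mixed_def X_def assms(2))
qed

text \<open>As the components \<Gamma>^t_{it} and \<Gamma>^i_{jk} vanish, parallelism of \<theta>
  and \<open>h\<close> makes both factors constant along the spatial fibres. The time components of
  the same equations then give \<Gamma>^t_{tt} and the trace condition.\<close>

lemma induced_structure:
  assumes "open I" "induced I \<theta> h \<Gamma>"
  obtains m f where "m holomorphic_on I" "f holomorphic_on I"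
    "\<And>t. t \<in> I \<Longrightarrow> m t \<noteq> 0" "\<And>t. t \<in> I \<Longrightarrow> f t \<noteq> 0"
    "\<And>x. x \<in> over I \<Longrightarrow> \<theta> x = m (x $ None) *s axis None 1"
    "\<And>x. x \<in> over I \<Longrightarrow> h x = nc_metric f x"
    "\<And>x. x \<in> over I \<Longrightarrow> \<Gamma> x None None None = deriv m (x $ None) / m (x $ None)"
    "\<And>x. x \<in> over I \<Longrightarrow> deriv f (x $ None) =
       - f (x $ None) * (\<Gamma> x (Some (0, 1)) None (Some (0, 1)) + \<Gamma> x (Some (1, 1)) None (Some (1, 1)))"
proof (rule induced_frame[OF assms(2)])
  fix \<mu> \<Delta> :: "pt \<Rightarrow> complex"
  assume holo: "holo_on (over I) \<mu>" "holo_on (over I) \<Delta>" and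
    nz: "\<And>x. x \<in> over I \<Longrightarrow> \<mu> x \<noteq> 0" "\<And>x. x \<in> over I \<Longrightarrow> \<Delta> x \<noteq> 0" and
    \<theta>: "\<And>x a. x \<in> over I \<Longrightarrow> \<theta> x $ a = (if a = None then \<mu> x else 0)" and
    hN: "\<And>x b. x \<in> over I \<Longrightarrow> h x $ None $ b = 0" "\<And>x a. x \<in> over I \<Longrightarrow> h x $ a $ None = 0" and
    h: "\<And>x i j. x \<in> over I \<Longrightarrow> h x $ Some i $ Some j = \<Delta> x * flat i j"
  have lam: "lambda_connection I \<Gamma>" and cp: "clock_parallel (over I) \<theta> \<Gamma>"
    and mp: "metric_parallel (over I) h \<Gamma>"
    using assms(2) unfolding induced_def by blast+
  note str = lambda_connection_structure[OF lam]
  note pdt = pd_transform[OF open_over[OF assms(1)]]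
  have clock: "pd b \<mu> x = \<Gamma> x None b None * \<mu> x" if "x \<in> over I" for x b
  proof -
    have "pd b (\<lambda>y. \<theta> y $ None) x = pd b \<mu> x"
      by (rule pdt[OF that]) (simp add: \<theta>)
    moreover have "pd b (\<lambda>y. \<theta> y $ None) x - (\<Sum>a\<in>UNIV. \<Gamma> x a b None * \<theta> x $ a) = 0"
      using cp that unfolding clock_parallel_def by blast
    ultimately show ?thesis by (simp add: sum_option \<theta>[OF that])
  qed
  have metric: "pd c \<Delta> x * flat i j + (\<Sum>d\<in>UNIV. \<Gamma> x (Some i) c (Some d) * (\<Delta> x * flat d j))
      + (\<Sum>d\<in>UNIV. \<Gamma> x (Some j) c (Some d) * (\<Delta> x * flat i d)) = 0" if "x \<in> over I" for x c i j
  proof -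
    have "pd c (\<lambda>y. h y $ Some i $ Some j) x = pd c (\<lambda>y. \<Delta> y * flat i j) x"
      by (rule pdt[OF that]) (simp add: h)
    also have "\<dots> = pd c \<Delta> x * flat i j"
      by (intro pd_eqI DERIV_cmult_right holo_on_pd[OF holo(2) that])
    finally have 1: "pd c (\<lambda>y. h y $ Some i $ Some j) x = pd c \<Delta> x * flat i j" .
    have "pd c (\<lambda>y. h y $ Some i $ Some j) x
        + (\<Sum>d\<in>UNIV. \<Gamma> x (Some i) c d * h x $ d $ Some j)
        + (\<Sum>d\<in>UNIV. \<Gamma> x (Some j) c d * h x $ Some i $ d) = 0"
      using mp that unfolding metric_parallel_def by blast
    then show ?thesis by (simp add: sum_option hN[OF that] h[OF that] 1)
  qed
  define m where "m t = \<mu> (at_time t)" for t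
  define f where "f t = \<Delta> (at_time t)" for t
  have m: "\<mu> x = m (x $ None)" if "x \<in> over I" for x
    unfolding m_def by (rule function_of_time[OF holo(1) _ that]) (simp add: clock str(2))
  have f: "\<Delta> x = f (x $ None)" if "x \<in> over I" for x
    unfolding f_def
  proof (rule function_of_time[OF holo(2) _ that])
    \<comment> \<open>The index pair (v, x) is taken because \<open>flat\<close> equals 1
      there.\<close>
    show "pd (Some k) \<Delta> y = 0" if "y \<in> over I" for y k
      using metric[OF that, of "Some k" "(0, 0)" "(1, 1)"] by (simp add: str(3)[OF that] flat_def)
  qed
  have md: "(m has_field_derivative pd None \<mu> (at_time t)) (at t)"
    and fd: "(f has_field_derivative pd None \<Delta> (at_time t)) (at t)" if "t \<in> I" for t
    unfolding m_def f_def by (intro holomorphic_at_time[OF _ that] holo)+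
  have pd\<mu>: "pd None \<mu> x = deriv m (x $ None)" and pd\<Delta>: "pd None \<Delta> x = deriv f (x $ None)"
    if "x \<in> over I" for x
  proof -
    have t: "x $ None \<in> I" using that by (simp add: over_def)
    have "pd None \<mu> x = pd None (\<lambda>y. m (y $ None)) x" by (rule pdt[OF that]) (simp add: m)
    also have "\<dots> = pd None \<mu> (at_time (x $ None))" by (simp add: pd_time[OF md[OF t]])
    also have "\<dots> = deriv m (x $ None)" by (rule DERIV_imp_deriv[OF md[OF t], symmetric])
    finally show "pd None \<mu> x = deriv m (x $ None)" .
    have "pd None \<Delta> x = pd None (\<lambda>y. f (y $ None)) x" by (rule pdt[OF that]) (simp add: f)
    also have "\<dots> = pd None \<Delta> (at_time (x $ None))" by (simp add: pd_time[OF fd[OF t]])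
    also have "\<dots> = deriv f (x $ None)" by (rule DERIV_imp_deriv[OF fd[OF t], symmetric])
    finally show "pd None \<Delta> x = deriv f (x $ None)" .
  qed
  show thesis
  proof (rule that)
    show "m holomorphic_on I" "f holomorphic_on I"
      using md fd by (auto simp: holomorphic_on_open[OF assms(1)])
    show "m t \<noteq> 0" "f t \<noteq> 0" if "t \<in> I" for t
      using nz[of "at_time t"] that by (auto simp: m_def f_def)
    fix x assume x: "x \<in> over I"
    show "\<theta> x = m (x $ None) *s axis None 1"
      by (simp add: vec_eq_iff axis_def \<theta>[OF x] m[OF x])
    show "h x = nc_metric f x"
      by (simp add: vec_eq_iff all_option hN[OF x] h[OF x] f[OF x])
    show "\<Gamma> x None None None = deriv m (x $ None) / m (x $ None)"
      using clock[OF x, of None] nz(1)[OF x] by (simp add: pd\<mu>[OF x] m[OF x])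
    \<comment> \<open>For mixed components S tensored with \<delta> the connection terms sum to tr S
      times \<open>h\<close>, so one entry carries the whole equation.\<close>
    show "deriv f (x $ None) =
       - f (x $ None) * (\<Gamma> x (Some (0, 1)) None (Some (0, 1)) + \<Gamma> x (Some (1, 1)) None (Some (1, 1)))"
      using metric[OF x, of None "(0, 0)" "(1, 1)"] str(4)[OF x, of 0 0 0 0]
      by (simp add: sum_spatial flat_def pd\<Delta>[OF x] f[OF x] algebra_simps eq_neg_iff_add_eq_0)
  qed
qed

text \<open>Lowering S tensored with \<delta> gives (eps S) tensored with eps, up to the factor 1/f.
  A 2x2 matrix S is trace-free exactly when eps S is symmetric, so removing the trace is what
  produces anti-self-duality.\<close>

lemma induced_coriolis:
  assumes "open I" "induced I \<theta> h \<Gamma>" "f holomorphic_on I" "\<And>t. t \<in> I \<Longrightarrow> f t \<noteq> 0"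
    and h: "\<And>x. x \<in> over I \<Longrightarrow> h x = nc_metric f x"
    and df: "\<And>x. x \<in> over I \<Longrightarrow> deriv f (x $ None) =
       - f (x $ None) * (\<Gamma> x (Some (0, 1)) None (Some (0, 1)) + \<Gamma> x (Some (1, 1)) None (Some (1, 1)))"
  shows "x \<in> over I \<Longrightarrow> anti_self_dual (coriolis h \<Gamma> x)"
    and "holo_on (over I) (\<lambda>x. coriolis h \<Gamma> x $ i $ j)"
    and "x \<in> over I \<Longrightarrow> nc_mixed f (coriolis h \<Gamma>) x i j = \<Gamma> x (Some i) (Some j) None"
proof -
  have lam: "lambda_connection I \<Gamma>"
    using assms(2) unfolding induced_def by blast
  note str = lambda_connection_structure[OF lam]
  define S where "S x A B = \<Gamma> x (Some (A, 1)) None (Some (B, 1))" for x A B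
  have mixed: "\<Gamma> x (Some i) (Some j) None = (if snd i = snd j then S x (fst i) (fst j) else 0)"
    if "x \<in> over I" for x i j
    using str(1)[OF that, of "Some i" "Some j" None] str(4)[OF that, of "fst i" "snd i" "fst j" "snd j"]
    by (simp add: S_def)
  \<comment> \<open>The primed \<delta> doubles the trace, so a quarter of the full trace is half of
    tr S.\<close>
  have tr: "(\<Sum>l\<in>UNIV. \<Gamma> x (Some l) (Some l) None) = 2 * (S x 0 0 + S x 1 1)" if "x \<in> over I" for x
    by (simp add: sum_spatial mixed[OF that])
  have f0: "f (x $ None) \<noteq> 0" if "x \<in> over I" for x
    using that assms(4) by (simp add: over_def)
  have W: "coriolis h \<Gamma> x $ i $ j = (\<Sum>k\<in>UNIV. flat i k / f (x $ None) *
      (\<Gamma> x (Some k) (Some j) None - (if k = j then (\<Sum>l\<in>UNIV. \<Gamma> x (Some l) (Some l) None) / 4 else 0)))"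
    if "x \<in> over I" for x i j
    by (simp add: coriolis_def h[OF that] spatial_metric_nc_metric[of f x, OF f0[OF that]])
  show "anti_self_dual (coriolis h \<Gamma> x)" if x: "x \<in> over I" for x
  proof -
    define \<phi> where "\<phi> A B = (\<Sum>C\<in>UNIV. eps A C *
      (S x C B - (if C = B then (S x 0 0 + S x 1 1) / 2 else 0))) / f (x $ None)" for A B
    have "\<phi> 0 1 = \<phi> 1 0"
      by (simp add: \<phi>_def sum_two field_simps)
    moreover have "\<forall>i j. coriolis h \<Gamma> x $ i $ j = \<phi> (fst i) (fst j) * eps (snd i) (snd j)"
      by (simp add: W[OF x] tr[OF x] mixed[OF x] \<phi>_def sum_two sum_spatial flat_def all_two)
        (simp add: field_simps f0[OF x])
    ultimately show ?thesis unfolding anti_self_dual_iff by blast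
  qed
  show "holo_on (over I) (\<lambda>x. coriolis h \<Gamma> x $ i $ j)" for i j
  proof (rule holo_on_transform[OF _ open_over[OF assms(1)] W[symmetric]])
    have fh: "holo_on (over I) (\<lambda>x. f (x $ None))"
      by (rule holo_on_time[OF assms(3,1)])
    have \<Gamma>h: "holo_on (over I) (\<lambda>x. \<Gamma> x a b c)" for a b c by (rule str(5)[OF assms(1)])
    have "holo_on (over I) (\<lambda>x. (\<Sum>l\<in>UNIV. \<Gamma> x (Some l) (Some l) None) / 4)"
      by (intro holo_on_divide holo_on_sum holo_on_const \<Gamma>h) simp
    then have "holo_on (over I) (\<lambda>x. if k = j then (\<Sum>l\<in>UNIV. \<Gamma> x (Some l) (Some l) None) / 4 else 0)" for k
      by (cases "k = j") auto
    then show "holo_on (over I) (\<lambda>x. \<Sum>k\<in>UNIV. flat i k / f (x $ None) * (\<Gamma> x (Some k) (Some j) None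
        - (if k = j then (\<Sum>l\<in>UNIV. \<Gamma> x (Some l) (Some l) None) / 4 else 0)))"
      using f0 by (intro holo_on_sum holo_on_mult holo_on_diff holo_on_divide holo_on_const fh \<Gamma>h) auto
  qed
  show "nc_mixed f (coriolis h \<Gamma>) x i j = \<Gamma> x (Some i) (Some j) None" if x: "x \<in> over I" for x i j
  proof -
    have "nc_mixed f (coriolis h \<Gamma>) x i j = nc_mixed f (coriolis (nc_metric f) \<Gamma>) x i j"
      using coriolis_cong[of h x "nc_metric f" \<Gamma>] h[OF x] by (simp add: nc_mixed_def)
    also have "\<dots> = \<Gamma> x (Some i) (Some j) None"
      by (rule nc_mixed_coriolis) (simp_all add: f0[OF x] df[OF x] tr[OF x] S_def)
    finally show ?thesis .
  qed
qed

section \<open>Realising arbitrary data\<close>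

lemma anti_self_dual_skew:
  assumes "anti_self_dual W"
  shows "W $ j $ i = - W $ i $ j"
proof -
  from assms have "transpose W = - W" by (simp only: anti_self_dual_def)
  from arg_cong[OF this, of "\<lambda>M. M $ i $ j"] show ?thesis by (simp add: transpose_def)
qed

text \<open>Raising \<phi>_{AB} eps_{A'B'} contracts two primed \<open>eps\<close> to a multiple of
  \<delta>. This is the shape that a \<Lambda>-connection demands.\<close>

lemma nc_mixed_anti_self_dual:
  assumes "anti_self_dual (W x)"
  shows "nc_mixed f W x (A, A') (B, B') = (if A' = B' then nc_mixed f W x (A, 1) (B, 1) else 0)"
proof -
  obtain \<phi> where "\<forall>i j. W x $ i $ j = \<phi> (fst i) (fst j) * eps (snd i) (snd j)"
    using assms unfolding anti_self_dual_iff by blast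
  then have "\<forall>A A' B B'. nc_mixed f W x (A, A') (B, B') =
      (if A' = B' then nc_mixed f W x (A, 1) (B, 1) else 0)"
    by (simp add: nc_mixed_def sum_spatial flat_def all_two)
  then show ?thesis by blast
qed

lemma skew_trace:
  assumes "\<And>i j. W $ j $ i = - W $ i $ j"
  shows "(\<Sum>l\<in>UNIV. \<Sum>k\<in>UNIV. c * flat l k * W $ k $ l) = 0"
proof -
  let ?T = "\<Sum>l\<in>UNIV. \<Sum>k\<in>UNIV. c * flat l k * W $ k $ l"
  have "?T = (\<Sum>k\<in>UNIV. \<Sum>l\<in>UNIV. c * flat l k * W $ k $ l)"
    by (rule sum.swap)
  also have "\<dots> = (\<Sum>k\<in>UNIV. \<Sum>l\<in>UNIV. - (c * flat k l * W $ l $ k))"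
    by (intro sum.cong refl) (subst assms, simp add: flat_sym)
  also have "\<dots> = - ?T" by (simp add: sum_negf)
  finally show ?thesis by simp
qed

text \<open>A skew form with one index raised by the symmetric \<open>flat\<close> has no trace, so
  the trace of the connection sits entirely in its f'/f term and is removed with it.\<close>

lemma coriolis_nc_connection:
  assumes "f (x $ None) \<noteq> 0" "anti_self_dual (W x)"
  shows "coriolis (nc_metric f) (nc_connection m f F W) x = W x"
proof -
  have tr: "(\<Sum>l\<in>UNIV. nc_connection m f F W x (Some l) (Some l) None) / 4 =
      - deriv f (x $ None) / (2 * f (x $ None))"
    by (simp add: nc_connection_def nc_mixed_def sum.distrib sum_subtractf skew_trace[OF anti_self_dual_skew[OF assms(2)]])
  have "coriolis (nc_metric f) (nc_connection m f F W) x $ i $ j = W x $ i $ j" for i j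
  proof -
    have "coriolis (nc_metric f) (nc_connection m f F W) x $ i $ j =
        (\<Sum>k\<in>UNIV. flat i k / f (x $ None) * (\<Sum>l\<in>UNIV. f (x $ None) * flat k l * W x $ l $ j))"
      unfolding coriolis_def tr
      by (simp add: spatial_metric_nc_metric[of f x, OF assms(1)])
        (auto simp: nc_connection_def nc_mixed_def intro!: sum.cong)
    also have "\<dots> = (\<Sum>k\<in>UNIV. \<Sum>l\<in>UNIV. flat i k * flat k l * W x $ l $ j)"
      using assms(1) by (simp add: sum_distrib_left mult.assoc)
    also have "\<dots> = (\<Sum>l\<in>UNIV. (\<Sum>k\<in>UNIV. flat i k * flat k l) * W x $ l $ j)"
      by (subst sum.swap) (simp add: sum_distrib_right)
    also have "\<dots> = W x $ i $ j"
      by (simp add: flat_flat if_distrib if_distribR cong: if_cong)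
    finally show ?thesis .
  qed
  then show ?thesis by (simp add: vec_eq_iff)
qed

text \<open>
  At a given \<open>\<lambda>\<close>, \<open>a = \<Gamma>\<^sup>t\<^sub>t\<^sub>t\<close>, \<open>\<Gamma>\<close> has mixed components \<open>S A B \<delta>\<close> with \<open>\<delta>\<close> in the primed indices, and \<open>G A\<close> is the
  section of \<open>\<O>(1)\<close> whose constant and linear coefficients are the components \<open>(A, 1)\<close> and \<open>(A, 0)\<close> of the
  force.
\<close>

definition nc_cochain ::
  "complex \<Rightarrow> (2 \<Rightarrow> 2 \<Rightarrow> complex) \<Rightarrow> (2 \<Rightarrow> complex) \<Rightarrow> fibre \<Rightarrow> fibre \<Rightarrow> fibre \<Rightarrow> complex" where
  "nc_cochain a S G \<mu> \<nu> \<rho> = (case (\<mu>, \<nu>, \<rho>) of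
     (None, None, None) \<Rightarrow> a
   | (Some A, None, None) \<Rightarrow> G A
   | (Some A, None, Some B) \<Rightarrow> S A B
   | (Some A, Some B, None) \<Rightarrow> S A B
   | _ \<Rightarrow> 0)"

lemma nc_cochain_simps [simp]:
  "nc_cochain a S G None None None = a"
  "nc_cochain a S G None (Some B) \<rho> = 0"
  "nc_cochain a S G None \<nu> (Some B) = 0"
  "nc_cochain a S G (Some A) None None = G A"
  "nc_cochain a S G (Some A) None (Some B) = S A B"
  "nc_cochain a S G (Some A) (Some B) None = S A B"
  "nc_cochain a S G (Some A) (Some B) (Some C) = 0"
  by (simp_all add: nc_cochain_def split: option.split)

lemma nc_connection_simps [simp]:
  "nc_connection m f F W x None None None = deriv m (x $ None) / m (x $ None)"
  "nc_connection m f F W x None (Some i) c = 0"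
  "nc_connection m f F W x None b (Some j) = 0"
  "nc_connection m f F W x (Some i) None None = F x $ i"
  "nc_connection m f F W x (Some i) (Some j) None = nc_mixed f W x i j"
  "nc_connection m f F W x (Some i) None (Some j) = nc_mixed f W x i j"
  "nc_connection m f F W x (Some i) (Some j) (Some k) = 0"
  by (simp_all add: nc_connection_def split: option.split)

lemma sum_line_diff:
  "(\<Sum>a\<in>UNIV. g a * line_diff x l $ None $ a) = g None"
  "(\<Sum>a\<in>UNIV. g a * line_diff x l $ Some A $ a) = g (Some (A, 1)) + g (Some (A, 0)) * l"
  using two_cases[of A] by (auto simp: sum_option sum_spatial line_diff_nth add.commute)

text \<open>The degree count for \<sigma> read backwards: constants fill the components in O, and
  the force fills those in O(1). Anti-self-duality of \<open>W\<close> is what lets \<open>S\<close>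
  reproduce the mixed components.\<close>

lemma lambda_connection_nc_connection:
  assumes "open I" "m holomorphic_on I" "\<And>t. t \<in> I \<Longrightarrow> m t \<noteq> 0"
    "f holomorphic_on I" "\<And>t. t \<in> I \<Longrightarrow> f t \<noteq> 0"
    "\<And>i. holo_on (over I) (\<lambda>x. F x $ i)" "\<And>i j. holo_on (over I) (\<lambda>x. W x $ i $ j)"
    "\<And>x. x \<in> over I \<Longrightarrow> anti_self_dual (W x)"
  shows "lambda_connection I (nc_connection m f F W)"
proof -
  define a where "a x = deriv m (x $ None) / m (x $ None)" for x :: pt
  define S where "S x A B = nc_mixed f W x (A, 1) (B, 1)" for x A B
  define \<sigma> where "\<sigma> x l = nc_cochain (a x) (S x) (\<lambda>A. F x $ (A, 1) + F x $ (A, 0) * l)" for x l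
  \<comment> \<open>In the other chart the coefficients of a section of O(1) change places:
    \<open>inverse l * (p + q * l) = p * inverse l + q\<close>.\<close>
  define \<sigma>' where "\<sigma>' x l = nc_cochain (a x) (S x) (\<lambda>A. F x $ (A, 1) * l + F x $ (A, 0))" for x l
  have nz: "m (x $ None) \<noteq> 0" "f (x $ None) \<noteq> 0" if "x \<in> over I" for x
    using that assms(3,5) by (auto simp: over_def)
  have ah: "holo_on (over I) a"
    unfolding a_def using nz assms(1,2)
    by (intro holo_on_divide holo_on_time holomorphic_deriv) auto
  have Sh: "holo_on (over I) (\<lambda>x. S x A B)" for A B
  proof -
    have "holo_on (over I) (\<lambda>x. - deriv f (x $ None) / (2 * f (x $ None)))"
      using nz assms(1,4)
      by (intro holo_on_divide holo_on_mult holo_on_uminus holo_on_const holo_on_time[of "deriv f"]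
          holo_on_time[of f] holomorphic_deriv) auto
    then have "holo_on (over I) (\<lambda>x. if A = B then - deriv f (x $ None) / (2 * f (x $ None)) else 0)"
      by (cases "A = B") auto
    moreover have "holo_on (over I) (\<lambda>x. \<Sum>k\<in>UNIV. f (x $ None) * flat (A, 1) k * W x $ k $ (B, 1))"
      by (intro holo_on_sum holo_on_mult holo_on_const holo_on_time assms)
    ultimately show ?thesis
      unfolding S_def nc_mixed_def by simp (rule holo_on_add)
  qed
  have tf: "torsion_free (over I) (nc_connection m f F W)"
    unfolding torsion_free_def
  proof (intro ballI allI)
    show "nc_connection m f F W x a b c = nc_connection m f F W x a c b" for x a b c
      by (cases a; cases b; cases c) simp_all
  qed
  have hol: "(\<lambda>l. \<sigma> x l \<mu> \<nu> \<rho>) holomorphic_on UNIV" "(\<lambda>l. \<sigma>' x l \<mu> \<nu> \<rho>) holomorphic_on UNIV"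
    for x \<mu> \<nu> \<rho>
    unfolding \<sigma>_def \<sigma>'_def by (cases \<mu>; cases \<nu>; cases \<rho>; simp; intro holomorphic_intros)+
  have holo: "holo_on (over I) (\<lambda>x. \<sigma> x l \<mu> \<nu> \<rho>)" "holo_on (over I) (\<lambda>x. \<sigma>' x l \<mu> \<nu> \<rho>)"
    for l \<mu> \<nu> \<rho>
    unfolding \<sigma>_def \<sigma>'_def
    by (cases \<mu>; cases \<nu>; cases \<rho>; simp; intro holo_on_const ah Sh holo_on_add holo_on_mult assms(6))+
  have sym: "\<sigma> x l \<mu> \<nu> \<rho> = \<sigma> x l \<mu> \<rho> \<nu>" "\<sigma>' x l \<mu> \<nu> \<rho> = \<sigma>' x l \<mu> \<rho> \<nu>" for x l \<mu> \<nu> \<rho>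
    unfolding \<sigma>_def \<sigma>'_def by (cases \<mu>; cases \<nu>; cases \<rho>; simp)+
  have tr: "weight l \<mu> * \<sigma> x l \<mu> \<alpha> \<beta> = \<sigma>' x (inverse l) \<mu> \<alpha> \<beta> * weight l \<alpha> * weight l \<beta>"
    if "l \<noteq> 0" for x l \<mu> \<alpha> \<beta>
    unfolding \<sigma>_def \<sigma>'_def using that by (cases \<mu>; cases \<alpha>; cases \<beta>; simp add: field_simps)
  have \<Gamma>: "(\<Sum>a\<in>UNIV. nc_connection m f F W x a b c * line_diff x l $ \<mu> $ a) =
      (\<Sum>\<nu>\<in>UNIV. \<Sum>\<rho>\<in>UNIV. \<sigma> x l \<mu> \<nu> \<rho> * line_diff x l $ \<nu> $ b * line_diff x l $ \<rho> $ c)"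
    if x: "x \<in> over I" for x l \<mu> b c
  proof -
    have mixed: "nc_mixed f W x (A, A') (B, B') = (if A' = B' then S x A B else 0)" for A A' B B'
      unfolding S_def by (rule nc_mixed_anti_self_dual[where W = W and x = x, OF assms(8)[OF x]])
    have delta: "(\<Sum>\<rho>\<in>UNIV. S x A \<rho> * (of_bool (\<rho> = B) * r)) = S x A B * r" for A B r
      using two_cases[of B] by (auto simp: sum_two)
    show ?thesis
    proof (cases \<mu>)
      case None
      then show ?thesis
        by (cases b; cases c) (auto simp: sum_line_diff \<sigma>_def sum_option line_diff_nth a_def)
    next
      case (Some A)
      have *: "nc_mixed f W x (A, 1) (B, B') + nc_mixed f W x (A, 0) (B, B') * l =
          S x A B * (if B' = 1 then 1 else l)" for B B'
        using two_cases[of B'] by (auto simp: mixed)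
      show ?thesis
        by (cases b; cases c)
          (auto simp: Some sum_line_diff \<sigma>_def sum_option line_diff_nth delta * mult.assoc)
    qed
  qed
  show ?thesis
    unfolding lambda_connection_iff
    by (intro conjI exI[of _ \<sigma>] exI[of _ \<sigma>'] allI ballI impI)
      (rule tf hol holo sym tr \<Gamma> | assumption)+
qed

lemma clock_parallel_nc_connection:
  assumes "open I" "m holomorphic_on I" "\<And>t. t \<in> I \<Longrightarrow> m t \<noteq> 0"
  shows "clock_parallel (over I) (\<lambda>x. m (x $ None) *s axis None 1) (nc_connection m f F W)"
  unfolding clock_parallel_def
proof (intro ballI allI)
  fix x b c assume x: "x \<in> over I"
  then have t: "x $ None \<in> I" by (simp add: over_def)
  have "pd b (\<lambda>y. m (y $ None)) x = (if b = None then deriv m (x $ None) else 0)"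
    by (rule pd_time[OF holomorphic_derivI[OF assms(2,1) t]])
  then have "pd b (\<lambda>y. (m (y $ None) *s axis None 1 :: complex ^ coord) $ c) x =
      (if b = None \<and> c = None then deriv m (x $ None) else 0)"
    by (cases c) (auto simp: axis_def)
  then show "pd b (\<lambda>y. (m (y $ None) *s axis None 1 :: complex ^ coord) $ c) x
      - (\<Sum>a\<in>UNIV. nc_connection m f F W x a b c * (m (x $ None) *s axis None 1) $ a) = 0"
    using assms(3)[OF t] by (cases b; cases c) (auto simp: sum_option axis_def)
qed

text \<open>In the time derivative, f' \<open>flat\<close> is cancelled by two contributions - f'/2
  \<open>flat\<close>, one for each index of \<open>h\<close>. The terms in \<open>W\<close> cancel
  because \<open>W\<close> with both indices raised, here \<open>R\<close>, is still skew.\<close>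

lemma metric_parallel_nc_connection:
  assumes "open I" "f holomorphic_on I" "\<And>t. t \<in> I \<Longrightarrow> f t \<noteq> 0"
    "\<And>x. x \<in> over I \<Longrightarrow> anti_self_dual (W x)"
  shows "metric_parallel (over I) (nc_metric f) (nc_connection m f F W)"
  unfolding metric_parallel_def
proof (intro ballI allI)
  fix x a b c assume x: "x \<in> over I"
  then have t: "x $ None \<in> I" by (simp add: over_def)
  have pd: "pd c (\<lambda>y. f (y $ None) * flat i j) x = (if c = None then deriv f (x $ None) * flat i j else 0)" for c i j
  proof -
    have "((\<lambda>t. f t * flat i j) has_field_derivative deriv f (x $ None) * flat i j) (at (x $ None))"
      by (intro DERIV_cmult_right holomorphic_derivI[OF assms(2,1) t])
    then show ?thesis by (rule pd_time)
  qed
  let ?f = "f (x $ None)" and ?f' = "deriv f (x $ None)"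
  define R where "R i j = (\<Sum>d\<in>UNIV. \<Sum>k\<in>UNIV. flat i k * W x $ k $ d * flat d j)" for i j
  have skew: "R j i = - R i j" for i j
  proof -
    have "R j i = (\<Sum>k\<in>UNIV. \<Sum>d\<in>UNIV. flat j k * W x $ k $ d * flat d i)"
      unfolding R_def by (rule sum.swap)
    also have "\<dots> = (\<Sum>k\<in>UNIV. \<Sum>d\<in>UNIV. - (flat i d * W x $ d $ k * flat k j))"
      by (intro sum.cong refl) (subst anti_self_dual_skew[OF assms(4)[OF x]], simp add: flat_sym)
    also have "\<dots> = - R i j"
      unfolding R_def by (simp add: sum_negf)
    finally show ?thesis .
  qed
  have sum: "(\<Sum>d\<in>UNIV. nc_mixed f W x i d * (?f * flat d j)) = - ?f' / 2 * flat i j + ?f ^ 2 * R i j" for i j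
  proof -
    have "nc_mixed f W x i d * (?f * flat d j) = (if i = d then - ?f' / 2 * flat d j else 0) +
        ?f ^ 2 * (\<Sum>k\<in>UNIV. flat i k * W x $ k $ d * flat d j)" for d
    proof -
      have "(\<Sum>k\<in>UNIV. ?f * flat i k * W x $ k $ d) * (?f * flat d j) =
          ?f ^ 2 * (\<Sum>k\<in>UNIV. flat i k * W x $ k $ d * flat d j)"
        by (simp add: sum_distrib_left sum_distrib_right power2_eq_square mult_ac)
      then show ?thesis
        unfolding nc_mixed_def distrib_right using assms(3)[OF t] by simp
    qed
    then have "(\<Sum>d\<in>UNIV. nc_mixed f W x i d * (?f * flat d j)) =
        (\<Sum>d\<in>UNIV. (if i = d then - ?f' / 2 * flat d j else 0)) +
        (\<Sum>d\<in>UNIV. ?f ^ 2 * (\<Sum>k\<in>UNIV. flat i k * W x $ k $ d * flat d j))"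
      by (simp only: sum.distrib)
    then show ?thesis by (simp add: R_def sum_distrib_left)
  qed
  have sum': "(\<Sum>d\<in>UNIV. nc_mixed f W x j d * (?f * flat i d)) = - ?f' / 2 * flat i j + ?f ^ 2 * R j i" for i j
    using sum[of j i] by (simp add: flat_sym)
  show "pd c (\<lambda>y. nc_metric f y $ a $ b) x
      + (\<Sum>d\<in>UNIV. nc_connection m f F W x a c d * nc_metric f x $ d $ b)
      + (\<Sum>d\<in>UNIV. nc_connection m f F W x b c d * nc_metric f x $ a $ d) = 0"
  proof (cases "a = None \<or> b = None \<or> c \<noteq> None")
    case True
    then show ?thesis
      by (cases a; cases b; cases c) (auto simp: sum_option pd)
  next
    case False
    then obtain i j where ij: "a = Some i" "b = Some j" "c = None"
      by (metis option.exhaust)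
    have "?f' * flat i j + (- ?f' / 2 * flat i j + ?f ^ 2 * R i j)
        + (- ?f' / 2 * flat i j + ?f ^ 2 * R j i) = 0"
      unfolding skew[of j i] by (simp add: field_simps)
    then show ?thesis
      unfolding ij nc_metric_nth pd by (simp add: sum_option sum sum')
  qed
qed


section \<open>Diagonal splittings realising a given clock and conformal factor\<close>

definition diagonal :: "('n \<Rightarrow> complex) \<Rightarrow> complex ^ 'n::finite ^ 'n" where
  "diagonal d = (\<chi> i j. if i = j then d i else 0)"

lemma diagonal_mult:
  "diagonal d ** A = (\<chi> i j. d i * A $ i $ j)"
  by (simp add: diagonal_def matrix_matrix_mult_def vec_eq_iff if_distrib if_distribR cong: if_cong)

lemma diagonal_mult_diagonal: "diagonal c ** diagonal d = diagonal (\<lambda>i. c i * d i)"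
  unfolding diagonal_mult by (simp add: diagonal_def vec_eq_iff)

lemma model_patch_diagonal: "model_patch l = diagonal (weight l)"
  by (simp add: vec_eq_iff model_patch_nth diagonal_def)

lemma matrix_inv_diagonal:
  assumes "\<And>i. d i \<noteq> 0"
  shows "matrix_inv (diagonal d) = diagonal (\<lambda>i. 1 / d i)" "invertible (diagonal d)"
proof -
  have "diagonal d ** diagonal (\<lambda>i. 1 / d i) = mat 1"
    using assms by (simp add: diagonal_mult vec_eq_iff) (simp add: diagonal_def mat_def)
  then show "matrix_inv (diagonal d) = diagonal (\<lambda>i. 1 / d i)" "invertible (diagonal d)"
    using matrix_inv_eqI invertible_right_inverse by blast+
qed

lemma induced_nc_connection:
  assumes "open I" "m holomorphic_on I" "\<And>t. t \<in> I \<Longrightarrow> m t \<noteq> 0"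
    "f holomorphic_on I" "\<And>t. t \<in> I \<Longrightarrow> f t \<noteq> 0"
    "\<And>i. holo_on (over I) (\<lambda>x. F x $ i)" "\<And>i j. holo_on (over I) (\<lambda>x. W x $ i $ j)"
    "\<And>x. x \<in> over I \<Longrightarrow> anti_self_dual (W x)"
  shows "induced I (\<lambda>x. m (x $ None) *s axis None 1) (nc_metric f) (nc_connection m f F W)"
proof -
  \<comment> \<open>The frame uses the inverse of \<open>H\<close>, so 1/m gives the clock m dt. The
    O(1) block needs determinant \<open>f\<close>; the entries f, 1 achieve this without a square
    root of \<open>f\<close>, which need not exist on \<open>I\<close>.\<close>
  define d where "d x \<mu> = (case \<mu> of None \<Rightarrow> 1 / m (x $ None) | Some A \<Rightarrow> if A = 0 then f (x $ None) else 1)"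
    for x :: pt and \<mu> :: fibre
  define H where "H x l = diagonal (d x)" for x and l :: complex
  define e where "e x i = (1 / d x (Some (fst i))) *s (axis (Some i) 1 :: complex ^ coord)" for x i
  have nz: "m (x $ None) \<noteq> 0" "f (x $ None) \<noteq> 0" if "x \<in> over I" for x
    using that assms(3,5) by (auto simp: over_def)
  have d0: "d x \<mu> \<noteq> 0" if "x \<in> over I" for x \<mu>
    using nz[OF that] by (auto simp: d_def split: option.split)
  have dh: "holo_on (over I) (\<lambda>x. d x \<mu>)" for \<mu>
  proof (cases \<mu>)
    case None
    then show ?thesis
      unfolding d_def None option.case using nz
      by (intro holo_on_divide holo_on_const holo_on_time assms(1,2)) auto
  next
    case (Some A)
    then show ?thesis
      unfolding d_def using assms by (cases "A = 0") (auto intro!: holo_on_time)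
  qed
  \<comment> \<open>Constant in \<open>l\<close> and diagonal, \<open>H\<close> commutes with the
    patching, so it serves in both charts.\<close>
  have "splitting I H H"
    unfolding splitting_def
  proof (intro conjI ballI allI impI)
    fix x l assume x: "x \<in> over I"
    show "(\<lambda>l. H x l $ \<mu> $ \<nu>) holomorphic_on UNIV" "(\<lambda>l. H x l $ \<mu> $ \<nu>) holomorphic_on UNIV" for \<mu> \<nu>
      by (simp_all add: H_def)
    show "invertible (H x l)" "invertible (H x l)"
      using matrix_inv_diagonal(2)[of "d x"] d0[OF x] by (simp_all add: H_def)
    show "patch1 x l = H x (inverse l) ** model_patch l ** matrix_inv (H x l)"
      using d0[OF x]
      by (simp add: H_def patch1_eq matrix_inv_diagonal(1) model_patch_diagonal diagonal_mult_diagonal)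
  next
    show "holo_on (over I) (\<lambda>x. H x l $ \<mu> $ \<nu>)" "holo_on (over I) (\<lambda>x. H x l $ \<mu> $ \<nu>)" for l \<mu> \<nu>
      using dh by (cases "\<mu> = \<nu>"; auto simp: H_def diagonal_def)+
  qed
  moreover have "frame_components I H (\<lambda>x. m (x $ None) *s axis None 1) e"
    unfolding frame_components_def
  proof (intro ballI allI conjI)
    fix x l assume x: "x \<in> over I"
    have fs: "frame_section H x l $ \<mu> $ a = 1 / d x \<mu> * line_diff x l $ \<mu> $ a" for \<mu> a
      using d0[OF x] by (simp add: frame_section_def H_def matrix_inv_diagonal(1) diagonal_mult)
    show "frame_section H x l $ None = m (x $ None) *s axis None 1"
      by (simp add: vec_eq_iff fs line_diff_nth axis_def d_def)
    show "frame_section H x l $ Some A = e x (A, 1) + l *s e x (A, 0)" for A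
      by (simp add: vec_eq_iff fs all_option line_diff_nth e_def axis_def all_two)
  qed
  moreover have "projective_inverse (m (x $ None) *s axis None 1) (degenerate_metric (e x)) (nc_metric f x)"
    if x: "x \<in> over I" for x
  proof -
    \<comment> \<open>Every non-zero term pairs the unprimed index 0 with 1, so it carries the
      factor 1/f exactly once.\<close>
    have g: "degenerate_metric (e x) = nc_metric (\<lambda>t. 1 / f t) x"
    proof -
      have "degenerate_metric (e x) $ a $ b = nc_metric (\<lambda>t. 1 / f t) x $ a $ b" for a b
      proof (cases a; cases b)
        fix i j assume "a = Some i" "b = Some j"
        moreover have "\<forall>i j. degenerate_metric (e x) $ Some i $ Some j = 1 / f (x $ None) * flat i j"
          by (simp add: degenerate_metric_def e_def axis_def sum_spatial all_two flat_def d_def)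
        then have "degenerate_metric (e x) $ Some i $ Some j = 1 / f (x $ None) * flat i j"
          by blast
        ultimately show ?thesis by simp
      qed (simp_all add: degenerate_metric_def e_def axis_def)
      then show ?thesis by (simp add: vec_eq_iff)
    qed
    have "clock_dual (m (x $ None) *s axis None 1) (nc_metric (\<lambda>t. 1 / f t) x) ((1 / m (x $ None)) *s axis None 1)"
      using nz[OF x] by (simp add: clock_dual_def sum_option axis_def vec_eq_iff matrix_vector_mult_def)
    moreover have "U = (1 / m (x $ None)) *s axis None 1"
      if U: "clock_dual (m (x $ None) *s axis None 1) (nc_metric (\<lambda>t. 1 / f t) x) U" for U
    proof -
      have "U \<in> vec.span {axis None 1}"
        using nc_metric_kernel[of "\<lambda>t. 1 / f t" x] nz[OF x] U by (auto simp: clock_dual_def)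
      then obtain k where k: "U = k *s axis None 1" by (auto simp: vec.span_singleton)
      then have "m (x $ None) * k = 1"
        using U by (simp add: clock_dual_def sum_option axis_def)
      then show ?thesis using nz[OF x] by (simp add: k field_simps)
    qed
    moreover have "nc_metric f x ** nc_metric (\<lambda>t. 1 / f t) x =
        mat 1 - (\<chi> a c. ((1 / m (x $ None)) *s axis None 1) $ a * (m (x $ None) *s axis None 1) $ c)"
    proof -
      have *: "(\<Sum>k\<in>UNIV. f (x $ None) * flat i k * (1 / f (x $ None) * flat k j)) = of_bool (i = j)" for i j
        using flat_flat[of i j] nz[OF x] by simp
      show ?thesis
        using nz[OF x] * by (simp add: vec_eq_iff all_option matrix_matrix_mult_def sum_option mat_def axis_def)
    qed
    moreover have "nc_metric f x *v (m (x $ None) *s axis None 1) = 0"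
      by (simp add: vec_eq_iff matrix_vector_mult_def sum_option axis_def)
    ultimately show ?thesis
      unfolding projective_inverse_def g by blast
  qed
  moreover have "lambda_connection I (nc_connection m f F W)"
    by (rule lambda_connection_nc_connection) (fact assms)+
  moreover have "clock_parallel (over I) (\<lambda>x. m (x $ None) *s axis None 1) (nc_connection m f F W)"
    by (rule clock_parallel_nc_connection) (fact assms)+
  moreover have "metric_parallel (over I) (nc_metric f) (nc_connection m f F W)"
    by (rule metric_parallel_nc_connection) (fact assms)+
  ultimately show ?thesis
    unfolding induced_def by blast
qed

section \<open>Changes of the time coordinate\<close>

lemma time_map_nth [simp]:
  "time_map \<tau> x $ None = \<tau> (x $ None)" "time_map \<tau> x $ Some i = x $ Some i"
  by (simp_all add: time_map_def)

lemma holo_on_time_map: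
  assumes "holo_on (over I) F" "g holomorphic_on K" "open K" "g ` K \<subseteq> I"
  shows "holo_on (over K) (\<lambda>y. F (time_map g y))"
  unfolding holo_on_def
proof
  fix y assume y: "y \<in> over K"
  then have t: "y $ None \<in> K" by (simp add: over_def)
  have "time_map g y \<in> over I"
    using t assms(4) by (auto simp: over_def)
  then obtain D where D: "(F has_derivative D) (at (time_map g y))" "\<forall>c v. D (c *s v) = c * D v"
    using assms(1) unfolding holo_on_def by blast
  have bl: "bounded_linear (\<lambda>z::complex. z *s (axis None 1 :: complex ^ coord))"
    by (intro linear_conv_bounded_linear[THEN iffD1] linearI) (auto simp: vec_eq_iff algebra_simps)
  \<comment> \<open>\<open>time_map g\<close> is treated as the identity plus a correction along the
    t axis, which makes its derivative a sum of known ones.\<close>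
  define G where "G v = v + (deriv g (y $ None) * v $ None - v $ None) *s axis None 1" for v :: pt
  have nth: "((\<lambda>y::pt. y $ None) has_derivative (\<lambda>v. v $ None)) (at y)"
    by (intro bounded_linear_imp_has_derivative bounded_linear_vec_nth)
  have "(g has_derivative (\<lambda>h. deriv g (y $ None) * h)) (at (y $ None))"
    using holomorphic_derivI[OF assms(2,3) t] by (simp add: has_field_derivative_def)
  from has_derivative_compose[OF nth this]
  have "((\<lambda>y::pt. g (y $ None) - y $ None) has_derivative
      (\<lambda>v. deriv g (y $ None) * v $ None - v $ None)) (at y)"
    by (intro has_derivative_diff nth)
  from has_derivative_add[OF has_derivative_ident bounded_linear.has_derivative[OF bl this]]
  have "((\<lambda>y. y + (g (y $ None) - y $ None) *s axis None 1) has_derivative G) (at y)"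
    by (simp add: G_def[abs_def])
  moreover have "(\<lambda>y. y + (g (y $ None) - y $ None) *s axis None 1) = time_map g"
    by (simp add: fun_eq_iff vec_eq_iff all_option axis_def)
  ultimately have "((\<lambda>y. F (time_map g y)) has_derivative (\<lambda>v. D (G v))) (at y)"
    using has_derivative_compose[of "time_map g" G y UNIV F D] D(1) by simp
  moreover have "G (c *s v) = c *s G v" for c v
    by (simp add: G_def vec_eq_iff algebra_simps)
  ultimately show "\<exists>D. ((\<lambda>y. F (time_map g y)) has_derivative D) (at y) \<and> (\<forall>c v. D (c *s v) = c * D v)"
    using D(2) by (intro exI[of _ "\<lambda>v. D (G v)"]) simp
qed

text \<open>Two restrictions of the domain are needed: a primitive of \<open>m\<close> is secured on
  a disc, and its non-zero derivative gives injectivity only on a smaller one. There the inverse is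
  holomorphic and the image open.\<close>

lemma time_coordinate:
  fixes m :: "complex \<Rightarrow> complex"
  assumes "open I" "m holomorphic_on I" "t \<in> I" "m t \<noteq> 0"
  obtains J \<tau> g where "open J" "t \<in> J" "J \<subseteq> I" "inj_on \<tau> J"
    "\<And>s. s \<in> J \<Longrightarrow> (\<tau> has_field_derivative m s) (at s)"
    "open (\<tau> ` J)" "g holomorphic_on \<tau> ` J" "\<And>s. s \<in> J \<Longrightarrow> g (\<tau> s) = s"
proof -
  obtain r where r: "r > 0" "ball t r \<subseteq> I"
    using assms(1,3) openE by blast
  obtain \<tau> where \<tau>0: "\<And>s. s \<in> ball t r \<Longrightarrow> (\<tau> has_field_derivative m s) (at s within ball t r)"
    using holomorphic_convex_primitive'[of "ball t r" m] holomorphic_on_subset[OF assms(2) r(2)] by auto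
  then have \<tau>: "(\<tau> has_field_derivative m s) (at s)" if "s \<in> ball t r" for s
    using \<tau>0[OF that] at_within_open[OF that open_ball] by simp
  then have hol: "\<tau> holomorphic_on ball t r"
    unfolding holomorphic_on_open[OF open_ball] by blast
  have "deriv \<tau> t \<noteq> 0"
    using DERIV_imp_deriv[OF \<tau>[of t]] r(1) assms(4) by simp
  then obtain q where q: "q > 0" "ball t q \<subseteq> ball t r" "inj_on \<tau> (ball t q)"
    using has_complex_derivative_locally_injective[OF hol, of t] r(1) by auto
  have hol': "\<tau> holomorphic_on ball t q"
    using hol q(2) holomorphic_on_subset by blast
  obtain g where "g holomorphic_on \<tau> ` ball t q" "\<And>s. s \<in> ball t q \<Longrightarrow> g (\<tau> s) = s"
    using holomorphic_has_inverse[OF hol' open_ball q(3)] by metis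
  moreover have "open (\<tau> ` ball t q)"
    by (rule open_mapping_thm3[OF hol' open_ball q(3)])
  moreover have "ball t q \<subseteq> I" using q(2) r(2) by blast
  moreover have "(\<tau> has_field_derivative m s) (at s)" if "s \<in> ball t q" for s
    using \<tau> that q(2) by blast
  ultimately show ?thesis
    using that[of "ball t q" \<tau> g] q(1,3) by simp
qed

lemma pd_time_map:
  assumes "open J" "\<And>s. s \<in> J \<Longrightarrow> (\<tau> has_field_derivative m s) (at s)" "x \<in> over J"
  shows "pd a (\<lambda>y. time_map \<tau> y $ d) x = (if a = d then if d = None then m (x $ None) else 1 else 0)"
proof (cases d)
  case None
  then show ?thesis
    using pd_time[OF assms(2), of x a] assms(3) by (simp add: over_def)
qed (simp add: pd_nth)

lemma pd_pd_time_map: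
  assumes "open J" "\<And>s. s \<in> J \<Longrightarrow> (\<tau> has_field_derivative m s) (at s)" "m holomorphic_on J" "x \<in> over J"
  shows "pd b (pd c (\<lambda>y. time_map \<tau> y $ d)) x =
    (if b = None \<and> c = None \<and> d = None then deriv m (x $ None) else 0)"
proof -
  have "pd b (pd c (\<lambda>y. time_map \<tau> y $ d)) x =
      pd b (\<lambda>y. if c = d then if d = None then m (y $ None) else 1 else 0) x"
    by (rule pd_transform[OF open_over[OF assms(1)] assms(4)]) (rule pd_time_map[OF assms(1,2)])
  also have "\<dots> = (if b = None \<and> c = None \<and> d = None then deriv m (x $ None) else 0)"
  proof (cases "c = d \<and> d = None")
    case True
    have "x $ None \<in> J" using assms(4) by (simp add: over_def)
    from pd_time[OF holomorphic_derivI[OF assms(3,1) this], of b] show ?thesis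
      using True by simp
  next
    case False
    then have "(\<lambda>y. if c = d then if d = None then m (y $ None) else 1 else 0) =
        (\<lambda>y::pt. if c = d then 1 else 0)"
      by auto
    with False show ?thesis by auto
  qed
  finally show ?thesis .
qed

lemma sum_mult_delta:
  fixes c :: "'n::finite \<Rightarrow> complex"
  shows "(\<Sum>a\<in>UNIV. c a * (if a = d then r else 0)) = c d * r"
    and "(\<Sum>a\<in>UNIV. c a * (if d = a then r else 0)) = c d * r"
proof -
  have "(\<Sum>a\<in>UNIV. c a * (if a = d then r else 0)) = (\<Sum>a\<in>UNIV. if a = d then c a * r else 0)"
    by (intro sum.cong) auto
  then show "(\<Sum>a\<in>UNIV. c a * (if a = d then r else 0)) = c d * r"
    by simp
  then show "(\<Sum>a\<in>UNIV. c a * (if d = a then r else 0)) = c d * r"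
    by (simp only: eq_commute[of d])
qed

text \<open>With d\<tau> = m dt, each lower time index costs a factor 1/m: two for the force, one
  for the Coriolis form, while \<open>f\<close> is only reparametrised. These data are fed to
  \<open>induced_nc_connection\<close>, so the new geometry is induced by construction and only the
  transformation law is left to check.\<close>

lemma normalise_clock:
  assumes "open I" "m holomorphic_on I" "\<And>t. t \<in> I \<Longrightarrow> m t \<noteq> 0"
    "f holomorphic_on I" "\<And>t. t \<in> I \<Longrightarrow> f t \<noteq> 0"
    "\<And>i. holo_on (over I) (\<lambda>x. F x $ i)" "\<And>i j. holo_on (over I) (\<lambda>x. W x $ i $ j)"
    "\<And>x. x \<in> over I \<Longrightarrow> anti_self_dual (W x)"
    and \<theta>: "\<And>x. x \<in> over I \<Longrightarrow> \<theta> x = m (x $ None) *s axis None 1"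
    and h: "\<And>x. x \<in> over I \<Longrightarrow> h x = nc_metric f x"
    and \<Gamma>: "\<And>x a b c. x \<in> over I \<Longrightarrow> \<Gamma> x a b c = nc_connection m f F W x a b c"
    and t: "t \<in> I"
  shows "\<exists>J \<tau> \<theta>' h' \<Gamma>'. open J \<and> t \<in> J \<and> J \<subseteq> I \<and> \<tau> holomorphic_on J \<and> inj_on \<tau> J \<and>
    carries (over J) (time_map \<tau>) \<theta> h \<Gamma> \<theta>' h' \<Gamma>' \<and> induced (\<tau> ` J) \<theta>' h' \<Gamma>' \<and>
    (\<forall>x\<in>over (\<tau> ` J). \<theta>' x = axis None 1)"
proof (rule time_coordinate[OF assms(1,2) t assms(3)[OF t]])
  fix J \<tau> g
  assume J: "open J" "t \<in> J" "J \<subseteq> I" "inj_on \<tau> J"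
    and \<tau>: "\<And>s. s \<in> J \<Longrightarrow> (\<tau> has_field_derivative m s) (at s)"
    and oJ: "open (\<tau> ` J)" and g: "g holomorphic_on \<tau> ` J" "\<And>s. s \<in> J \<Longrightarrow> g (\<tau> s) = s"
  let ?K = "\<tau> ` J"
  have gK: "g ` ?K \<subseteq> I" "g ` ?K \<subseteq> J" using g(2) J(3) by auto
  define f' where "f' s = f (g s)" for s
  define F' where "F' y = (\<chi> i. F (time_map g y) $ i / m (g (y $ None)) ^ 2)" for y
  define W' where "W' y = (\<chi> i j. W (time_map g y) $ i $ j / m (g (y $ None)))" for y
  have mg: "(\<lambda>s. m (g s)) holomorphic_on ?K"
    using holomorphic_on_compose_gen[OF g(1) assms(2) gK(1)] by (simp add: o_def)
  have mg0: "m (g (y $ None)) \<noteq> 0" if "y \<in> over ?K" for y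
    using that gK(1) assms(3) by (auto simp: over_def)
  have dg: "(g has_field_derivative 1 / m s) (at (\<tau> s))" if s: "s \<in> J" for s
  proof -
    have d: "(g has_field_derivative deriv g (\<tau> s)) (at (\<tau> s))"
      using s by (intro holomorphic_derivI[OF g(1) oJ]) auto
    have "((\<lambda>z. g (\<tau> z)) has_field_derivative deriv g (\<tau> s) * m s) (at s)"
      by (rule DERIV_chain2[OF d \<tau>[OF s]])
    moreover have "((\<lambda>z. g (\<tau> z)) has_field_derivative 1) (at s)"
      by (rule has_field_derivative_transform_within_open[OF DERIV_ident J(1) s]) (simp add: g(2))
    ultimately have "deriv g (\<tau> s) * m s = 1" by (rule DERIV_unique)
    moreover have "m s \<noteq> 0" using s J(3) assms(3) by auto
    ultimately have "deriv g (\<tau> s) = 1 / m s" by (simp add: field_simps)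
    with d show ?thesis by simp
  qed
  \<comment> \<open>The chain rule supplies the same factor 1/m as in \<open>W'\<close>, so both
    summands of \<open>nc_mixed\<close> scale alike.\<close>
  have df': "deriv f' (\<tau> s) = deriv f s / m s" if s: "s \<in> J" for s
  proof -
    have "(f has_field_derivative deriv f s) (at (g (\<tau> s)))"
      using s J(3) by (auto simp: g(2) intro!: holomorphic_derivI[OF assms(4,1)])
    from DERIV_chain2[OF this dg[OF s]] show ?thesis
      unfolding f'_def by (auto intro!: DERIV_imp_deriv)
  qed
  have ind: "induced ?K (\<lambda>x. (\<lambda>_. 1) (x $ None) *s axis None 1) (nc_metric f') (nc_connection (\<lambda>_. 1) f' F' W')"
  proof (rule induced_nc_connection)
    show "open ?K" by (rule oJ)
    show "f' holomorphic_on ?K"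
      using holomorphic_on_compose_gen[OF g(1) assms(4) gK(1)] by (simp add: o_def f'_def[abs_def])
    show "f' s \<noteq> 0" if "s \<in> ?K" for s
      using that gK(1) assms(5) by (auto simp: f'_def)
    show "holo_on (over ?K) (\<lambda>x. F' x $ i)" for i
      unfolding F'_def power2_eq_square vec_lambda_beta using mg0
      by (intro holo_on_divide holo_on_mult holo_on_time_map[OF assms(6) g(1) oJ gK(1)] holo_on_time[OF mg oJ]) auto
    show "holo_on (over ?K) (\<lambda>x. W' x $ i $ j)" for i j
      unfolding W'_def vec_lambda_beta using mg0
      by (intro holo_on_divide holo_on_time_map[OF assms(7) g(1) oJ gK(1)] holo_on_time[OF mg oJ]) auto
    show "anti_self_dual (W' y)" if "y \<in> over ?K" for y
    proof -
      have "time_map g y \<in> over I" using that gK(1) by (auto simp: over_def)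
      from assms(8)[OF this] obtain \<phi> where "\<phi> 0 1 = \<phi> 1 0"
        "\<forall>i j. W (time_map g y) $ i $ j = \<phi> (fst i) (fst j) * eps (snd i) (snd j)"
        unfolding anti_self_dual_iff by blast
      then show ?thesis
        unfolding anti_self_dual_iff W'_def
        by (intro exI[of _ "\<lambda>A B. \<phi> A B / m (g (y $ None))"]) simp
    qed
  qed (auto intro: holomorphic_intros)
  have "carries (over J) (time_map \<tau>) \<theta> h \<Gamma> (\<lambda>x. axis None 1) (nc_metric f') (nc_connection (\<lambda>_. 1) f' F' W')"
    unfolding carries_def Let_def
  proof (intro ballI conjI allI)
    fix x assume x: "x \<in> over J"
    define s where "s = x $ None"
    have s: "s \<in> J" using x by (simp add: over_def s_def)
    have xI: "x \<in> over I" using s J(3) by (auto simp: over_def s_def)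
    have m0: "m s \<noteq> 0" using s J(3) assms(3) by auto
    define j where "j a = (if a = None then m s else 1)" for a :: coord
    have pd: "pd a (\<lambda>y. time_map \<tau> y $ d) x = (if a = d then j d else 0)" for a d
      by (simp add: pd_time_map[OF J(1) \<tau> x] j_def s_def)
    have pdpd: "pd b (pd c (\<lambda>y. time_map \<tau> y $ d)) x =
        (if b = None \<and> c = None \<and> d = None then deriv m (x $ None) else 0)" for b c d
      by (rule pd_pd_time_map[OF J(1) \<tau> holomorphic_on_subset[OF assms(2) J(3)] x])
    have inv: "time_map g (time_map \<tau> x) = x"
      using g(2)[OF s] by (simp add: vec_eq_iff all_option s_def)
    show "\<theta> x $ a = (\<Sum>d\<in>UNIV. axis None 1 $ d * pd a (\<lambda>y. time_map \<tau> y $ d) x)" for a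
    proof -
      have "(\<Sum>d\<in>UNIV. axis None 1 $ d * pd a (\<lambda>y. time_map \<tau> y $ d) x) =
          (\<Sum>d\<in>UNIV. axis None 1 $ d * (if a = d then j a else 0))"
        by (intro sum.cong refl) (simp add: pd)
      also have "\<dots> = axis None 1 $ a * j a" by (rule sum_mult_delta)
      also have "\<dots> = \<theta> x $ a" by (simp add: \<theta>[OF xI] axis_def j_def s_def)
      finally show ?thesis by simp
    qed
    show "nc_metric f' (time_map \<tau> x) $ d $ e = (\<Sum>a\<in>UNIV. \<Sum>b\<in>UNIV. h x $ a $ b *
        pd a (\<lambda>y. time_map \<tau> y $ d) x * pd b (\<lambda>y. time_map \<tau> y $ e) x)" for d e
    proof -
      have "(\<Sum>a\<in>UNIV. \<Sum>b\<in>UNIV. h x $ a $ b *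
          pd a (\<lambda>y. time_map \<tau> y $ d) x * pd b (\<lambda>y. time_map \<tau> y $ e) x) = h x $ d $ e * j d * j e"
        by (simp only: pd sum_mult_delta sum_distrib_right[symmetric])
      also have "\<dots> = nc_metric f' (time_map \<tau> x) $ d $ e"
        using g(2)[OF s] by (cases d; cases e) (simp_all add: h[OF xI] j_def f'_def s_def)
      finally show ?thesis by simp
    qed
    show "(\<Sum>a\<in>UNIV. \<Gamma> x a b c * pd a (\<lambda>y. time_map \<tau> y $ d) x) =
        pd b (pd c (\<lambda>y. time_map \<tau> y $ d)) x
        + (\<Sum>e\<in>UNIV. \<Sum>g\<in>UNIV. nc_connection (\<lambda>_. 1) f' F' W' (time_map \<tau> x) d e g *
            pd b (\<lambda>y. time_map \<tau> y $ e) x * pd c (\<lambda>y. time_map \<tau> y $ g) x)" for d b c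
    proof -
      let ?\<Gamma>' = "nc_connection (\<lambda>_. 1) f' F' W' (time_map \<tau> x)"
      have 1: "(\<Sum>a\<in>UNIV. \<Gamma> x a b c * pd a (\<lambda>y. time_map \<tau> y $ d) x) = \<Gamma> x d b c * j d"
        unfolding pd by (rule sum_mult_delta)
      have 2: "(\<Sum>e\<in>UNIV. \<Sum>g\<in>UNIV. ?\<Gamma>' d e g *
            pd b (\<lambda>y. time_map \<tau> y $ e) x * pd c (\<lambda>y. time_map \<tau> y $ g) x) = ?\<Gamma>' d b c * j b * j c"
      proof -
        have pd': "pd a (\<lambda>y. time_map \<tau> y $ e) x = (if a = e then j a else 0)" for a e
          by (simp add: pd)
        show ?thesis by (simp only: pd' sum_mult_delta sum_distrib_right[symmetric])
      qed
      have mixed: "nc_mixed f' W' (time_map \<tau> x) i k * m s = nc_mixed f W x i k" for i k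
        using m0 g(2)[OF s]
        by (simp add: nc_mixed_def W'_def inv df'[OF s] f'_def s_def[symmetric] distrib_right
            sum_distrib_right)
      have force: "F' (time_map \<tau> x) $ i * (m s * m s) = F x $ i" for i
        using m0 g(2)[OF s] by (simp add: F'_def inv s_def[symmetric] power2_eq_square)
      \<comment> \<open>The inhomogeneous term m' occurs only for \<open>d\<close>,
        \<open>b\<close>, \<open>c\<close> all \<open>None\<close>, where it equals m times the old
        \<Gamma>^t_{tt}; the new one is therefore zero, as the clock factor 1 requires.\<close>
      show ?thesis
        unfolding 1 2 pdpd unfolding \<Gamma>[OF xI]
        using m0 by (cases d; cases b; cases c) (auto simp: j_def s_def[symmetric] mixed force mult.assoc)
    qed
  qed
  moreover have "\<tau> holomorphic_on J"
    using \<tau> J(1) by (auto simp: holomorphic_on_open)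
  ultimately show ?thesis
    using J ind by (intro exI[of _ J] exI[of _ \<tau>] exI[of _ "\<lambda>x. axis None 1"] exI[of _ "nc_metric f'"]
      exI[of _ "nc_connection (\<lambda>_. 1) f' F' W'"]) simp
qed

section \<open>Necessity and sufficiency of the description by free data\<close>

lemma newton_cartan_if_induced:
  assumes "open I" "induced I \<theta> h \<Gamma>" "m holomorphic_on I" "f holomorphic_on I"
    "\<And>t. t \<in> I \<Longrightarrow> m t \<noteq> 0" "\<And>t. t \<in> I \<Longrightarrow> f t \<noteq> 0"
    and \<theta>: "\<And>x. x \<in> over I \<Longrightarrow> \<theta> x = m (x $ None) *s axis None 1"
    and h: "\<And>x. x \<in> over I \<Longrightarrow> h x = nc_metric f x"
  shows "newton_cartan I \<theta> h \<Gamma>"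
  unfolding newton_cartan_def
proof (intro conjI allI ballI)
  have lam: "lambda_connection I \<Gamma>" and cp: "clock_parallel (over I) \<theta> \<Gamma>"
    and mp: "metric_parallel (over I) h \<Gamma>"
    using assms(2) unfolding induced_def by blast+
  note oI = open_over[OF assms(1)]
  show "holo_on (over I) (\<lambda>x. \<theta> x $ a)" for a
  proof (rule holo_on_transform[OF _ oI])
    show "holo_on (over I) (\<lambda>x. m (x $ None) * axis None 1 $ a)"
      by (intro holo_on_mult holo_on_const holo_on_time assms(1,3))
  qed (simp add: \<theta>)
  show "holo_on (over I) (\<lambda>x. h x $ a $ b)" for a b
  proof (rule holo_on_transform[OF _ oI])
    show "holo_on (over I) (\<lambda>x. nc_metric f x $ a $ b)"
      by (cases a; cases b; simp; intro holo_on_mult holo_on_const holo_on_time assms(1,4))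
  qed (simp add: h)
  show "holo_on (over I) (\<lambda>x. \<Gamma> x a b c)" for a b c
    by (rule lambda_connection_structure(5)[OF lam assms(1)])
  fix x assume x: "x \<in> over I"
  then have t: "x $ None \<in> I" by (simp add: over_def)
  show "transpose (h x) = h x" "rank (h x) = 4"
    using assms(6)[OF t] by (simp_all add: h[OF x] nc_metric_transpose nc_metric_rank)
  show "pd a (\<lambda>y. \<theta> y $ b) x = pd b (\<lambda>y. \<theta> y $ a) x" for a b
  proof -
    have "pd a (\<lambda>y. \<theta> y $ b) x = (if a = None \<and> b = None then deriv m (x $ None) else 0)" for a b
    proof (cases b)
      case None
      have "pd a (\<lambda>y. \<theta> y $ b) x = pd a (\<lambda>y. m (y $ None)) x"
        by (rule pd_transform[OF oI x]) (simp add: \<theta> None axis_def)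
      then show ?thesis
        using pd_time[OF holomorphic_derivI[OF assms(3,1) t], of a] None by simp
    next
      case (Some i)
      have "pd a (\<lambda>y. \<theta> y $ b) x = pd a (\<lambda>y. 0) x"
        by (rule pd_transform[OF oI x]) (simp add: \<theta> Some axis_def)
      with Some show ?thesis by simp
    qed
    then show ?thesis by auto
  qed
  show "{\<alpha>. h x *v \<alpha> = 0} = vec.span {\<theta> x}"
  proof -
    have "vec.span {m (x $ None) *s axis None 1} = vec.span {axis None 1 :: complex ^ coord}"
      using vec.span_image_scale[of "{axis None 1}" "\<lambda>_. m (x $ None)"] assms(5)[OF t] by simp
    then show ?thesis
      using assms(6)[OF t] by (simp add: h[OF x] \<theta>[OF x] nc_metric_kernel)
  qed
next
  show "torsion_free (over I) \<Gamma>"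
    using assms(2) unfolding induced_def lambda_connection_def by (elim conjE)
  show "metric_parallel (over I) h \<Gamma>" "clock_parallel (over I) \<theta> \<Gamma>"
    using assms(2) unfolding induced_def by blast+
qed

lemma conformal_factor_nc_metric:
  assumes "f holomorphic_on I" "\<And>t. t \<in> I \<Longrightarrow> f t \<noteq> 0" "\<And>x. x \<in> over I \<Longrightarrow> h x = nc_metric f x"
  shows "conformal_factor I h f"
  using assms unfolding conformal_factor_def by (simp add: nc_metric_def)

lemma induced_geometry:
  assumes "open I" "induced I \<theta> h \<Gamma>"
  shows "newton_cartan I \<theta> h \<Gamma> \<and>
       (\<exists>m f. m holomorphic_on I \<and> (\<forall>t\<in>I. m t \<noteq> 0) \<and>
          (\<forall>x\<in>over I. \<theta> x = m (x $ None) *s axis None 1) \<and>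
          conformal_factor I h f \<and>
          (\<forall>x\<in>over I. anti_self_dual (coriolis h \<Gamma> x)) \<and>
          (\<forall>i j. holo_on (over I) (\<lambda>x. coriolis h \<Gamma> x $ i $ j)) \<and>
          (\<forall>x\<in>over I. \<forall>a b c.
             \<Gamma> x a b c = nc_connection m f (gravitational_force \<Gamma>) (coriolis h \<Gamma>) x a b c)) \<and>
       (\<forall>t\<in>I. \<exists>J \<tau> \<theta>' h' \<Gamma>'. open J \<and> t \<in> J \<and> J \<subseteq> I \<and>
          \<tau> holomorphic_on J \<and> inj_on \<tau> J \<and>
          carries (over J) (time_map \<tau>) \<theta> h \<Gamma> \<theta>' h' \<Gamma>' \<and>
          induced (\<tau> ` J) \<theta>' h' \<Gamma>' \<and>
          (\<forall>x\<in>over (\<tau> ` J). \<theta>' x = axis None 1))"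
proof (rule induced_structure[OF assms])
  fix m f
  assume hol: "m holomorphic_on I" "f holomorphic_on I"
    and m0: "\<And>t. t \<in> I \<Longrightarrow> m t \<noteq> 0" and f0: "\<And>t. t \<in> I \<Longrightarrow> f t \<noteq> 0"
    and \<theta>: "\<And>x. x \<in> over I \<Longrightarrow> \<theta> x = m (x $ None) *s axis None 1"
    and h: "\<And>x. x \<in> over I \<Longrightarrow> h x = nc_metric f x"
    and \<Gamma>t: "\<And>x. x \<in> over I \<Longrightarrow> \<Gamma> x None None None = deriv m (x $ None) / m (x $ None)"
    and df: "\<And>x. x \<in> over I \<Longrightarrow> deriv f (x $ None) =
       - f (x $ None) * (\<Gamma> x (Some (0, 1)) None (Some (0, 1)) + \<Gamma> x (Some (1, 1)) None (Some (1, 1)))"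
  have lam: "lambda_connection I \<Gamma>"
    using assms(2) unfolding induced_def by blast
  note str = lambda_connection_structure[OF lam]
  let ?F = "gravitational_force \<Gamma>" and ?W = "coriolis h \<Gamma>"
  have asd: "anti_self_dual (?W x)" if "x \<in> over I" for x
    by (rule induced_coriolis(1)[OF assms hol(2) f0 h df that])
  have Wh: "holo_on (over I) (\<lambda>x. ?W x $ i $ j)" for i j
    by (rule induced_coriolis(2)[OF assms hol(2) f0 h df])
  have Fh: "holo_on (over I) (\<lambda>x. ?F x $ i)" for i
    using str(5)[OF assms(1)] by (simp add: gravitational_force_def)
  \<comment> \<open>The clock fixes \<Gamma>^t_{tt}, the force is read off, trace and Coriolis form
    give the mixed components, and the others vanish by degree.\<close>
  have \<Gamma>: "\<Gamma> x a b c = nc_connection m f ?F ?W x a b c" if x: "x \<in> over I" for x a b c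
  proof -
    have mixed: "nc_mixed f ?W x i j = \<Gamma> x (Some i) (Some j) None" for i j
      by (rule induced_coriolis(3)[OF assms hol(2) f0 h df x])
    have sym: "\<Gamma> x a None (Some j) = \<Gamma> x a (Some j) None" for a j
      by (rule str(1)[OF x])
    show ?thesis
      by (cases a; cases b; cases c)
        (simp_all add: \<Gamma>t[OF x] mixed sym str(2,3)[OF x] gravitational_force_def)
  qed
  have "newton_cartan I \<theta> h \<Gamma>"
    by (rule newton_cartan_if_induced[OF assms hol m0 f0 \<theta> h])
  moreover have "conformal_factor I h f"
    by (rule conformal_factor_nc_metric[OF hol(2) f0 h])
  moreover have "\<forall>t\<in>I. \<exists>J \<tau> \<theta>' h' \<Gamma>'. open J \<and> t \<in> J \<and> J \<subseteq> I \<and>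
          \<tau> holomorphic_on J \<and> inj_on \<tau> J \<and>
          carries (over J) (time_map \<tau>) \<theta> h \<Gamma> \<theta>' h' \<Gamma>' \<and>
          induced (\<tau> ` J) \<theta>' h' \<Gamma>' \<and>
          (\<forall>x\<in>over (\<tau> ` J). \<theta>' x = axis None 1)"
    by (intro ballI normalise_clock[OF assms(1) hol(1) m0 hol(2) f0 Fh Wh asd \<theta> h \<Gamma>])
  ultimately show ?thesis
    using hol(1) m0 \<theta> asd Wh \<Gamma> by blast
qed

text \<open>Together with the decomposition of an arbitrary induced connection, this is what
  justifies the word arbitrary: every choice of force and anti-self-dual form occurs.\<close>

lemma geometry_from_data:
  assumes "open I" "m holomorphic_on I" "\<forall>t\<in>I. m t \<noteq> 0" "f holomorphic_on I" "\<forall>t\<in>I. f t \<noteq> 0"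
    "\<forall>i. holo_on (over I) (\<lambda>x. F x $ i)" "\<forall>i j. holo_on (over I) (\<lambda>x. W x $ i $ j)"
    "\<forall>x\<in>over I. anti_self_dual (W x)"
  shows "\<exists>\<theta> h \<Gamma>. induced I \<theta> h \<Gamma> \<and>
          (\<forall>x\<in>over I. \<theta> x = m (x $ None) *s axis None 1) \<and>
          conformal_factor I h f \<and>
          (\<forall>x\<in>over I. gravitational_force \<Gamma> x = F x \<and> coriolis h \<Gamma> x = W x)"
proof (intro exI conjI ballI)
  show "induced I (\<lambda>x. m (x $ None) *s axis None 1) (nc_metric f) (nc_connection m f F W)"
    by (rule induced_nc_connection) (use assms in blast)+
  show "conformal_factor I (nc_metric f) f"
    by (rule conformal_factor_nc_metric) (use assms in auto)
  fix x assume x: "x \<in> over I"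
  show "gravitational_force (nc_connection m f F W) x = F x"
    by (simp add: gravitational_force_def vec_eq_iff)
  show "coriolis (nc_metric f) (nc_connection m f F W) x = W x"
    by (rule coriolis_nc_connection) (use assms x in \<open>auto simp: over_def\<close>)
qed simp

theorem theorem5p1:
  shows "bij_betw line UNIV global_sections \<and>
    (\<forall>I \<theta> h \<Gamma>. open I \<and> induced I \<theta> h \<Gamma> \<longrightarrow>
       newton_cartan I \<theta> h \<Gamma> \<and>
       (\<exists>m f. m holomorphic_on I \<and> (\<forall>t\<in>I. m t \<noteq> 0) \<and>
          (\<forall>x\<in>over I. \<theta> x = m (x $ None) *s axis None 1) \<and>
          conformal_factor I h f \<and>
          (\<forall>x\<in>over I. anti_self_dual (coriolis h \<Gamma> x)) \<and>
          (\<forall>i j. holo_on (over I) (\<lambda>x. coriolis h \<Gamma> x $ i $ j)) \<and>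
          (\<forall>x\<in>over I. \<forall>a b c.
             \<Gamma> x a b c = nc_connection m f (gravitational_force \<Gamma>) (coriolis h \<Gamma>) x a b c)) \<and>
       (\<forall>t\<in>I. \<exists>J \<tau> \<theta>' h' \<Gamma>'. open J \<and> t \<in> J \<and> J \<subseteq> I \<and>
          \<tau> holomorphic_on J \<and> inj_on \<tau> J \<and>
          carries (over J) (time_map \<tau>) \<theta> h \<Gamma> \<theta>' h' \<Gamma>' \<and>
          induced (\<tau> ` J) \<theta>' h' \<Gamma>' \<and>
          (\<forall>x\<in>over (\<tau> ` J). \<theta>' x = axis None 1))) \<and>
    (\<forall>I m f F W. open I \<and>
       m holomorphic_on I \<and> (\<forall>t\<in>I. m t \<noteq> 0) \<and>
       f holomorphic_on I \<and> (\<forall>t\<in>I. f t \<noteq> 0) \<and>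
       (\<forall>i. holo_on (over I) (\<lambda>x. F x $ i)) \<and>
       (\<forall>i j. holo_on (over I) (\<lambda>x. W x $ i $ j)) \<and>
       (\<forall>x\<in>over I. anti_self_dual (W x)) \<longrightarrow>
       (\<exists>\<theta> h \<Gamma>. induced I \<theta> h \<Gamma> \<and>
          (\<forall>x\<in>over I. \<theta> x = m (x $ None) *s axis None 1) \<and>
          conformal_factor I h f \<and>
          (\<forall>x\<in>over I. gravitational_force \<Gamma> x = F x \<and> coriolis h \<Gamma> x = W x))) \<and>
    (\<forall>a b c. \<exists>!W. anti_self_dual W \<and>
       W $ (0, 0) $ (0, 1) = a \<and> W $ (1, 0) $ (1, 1) = b \<and> W $ (0, 0) $ (1, 1) = c)"
proof (rule conjI[OF bij_betw_line conjI[OF _ conjI]], goal_cases)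
  case 1
  then show ?case
    by (intro allI impI, elim conjE) (rule induced_geometry)
next
  case 2
  then show ?case
    by (intro allI impI, elim conjE) (rule geometry_from_data)
next
  case 3
  then show ?case
    by (intro allI anti_self_dual_components)
qed

end
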